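(* Let $M$ be a compact manifold embedded in $\mathbb{R}^\ell$, let $A$ be a non-singular $n\times n$ integer matrix, and let $k\ge 1$ be an integer. For every $\eta>0$ there exists $\epsilon>0$ such that the following holds. Let $\rho:\Gamma_A\to\mathrm{Diff}^1(M)$ be a $C^1$ action with $d_{C^1}(\rho,\mathrm{id})<\epsilon$, and write $f=\rho(a)$, $g_i=\rho(b_i)$. Then for every $x\in M$, setting $y=f^k(x)$, for every $1\le j\le \ell$, $$\big\|(D(x))_j-A^k(D(y))_j\big\|\le \eta\sqrt{n\ell}\Big(2\max_{1\le m\le\ell}\|(D(x))_m\|+\max_{1\le m\le \ell}\|(D(y))_m\|\Big).$$
   Context: $\Gamma_A=\langle a,b_1,\dots,b_n \mid b_ib_j=b_jb_i,\ a b_i a^{-1}=\prod_j b_j^{A_{ij}}\rangle$. $M\subset\mathbb{R}^\ell$ carries the Euclidean norm; for $C^1$ maps $h:M\to\mathbb{R}^\ell$, $\|h\|_1=\sup_{x\in M}\{\|h(x)\|+\|D_xh\|\}$, $d(h,g)=\|h-g\|_1$, and $d_{C^1}(\rho,\mathrm{id})=\max\{d(\rho(a),\mathrm{id}),d(\rho(b_i),\mathrm{id}):1\le i\le n\}$. For $x\in M$, $G_i(x)=g_i(x)-x\in\mathbb{R}^\ell$, and $D(x)$ is the $n\times\ell$ displacement matrix whose $i$-th row is the row vector $G_i(x)$. $(D(x))_j\in\mathbb{R}^n$ denotes the $j$-th column of $D(x)$, and $A^k(D(y))_j$ is the matrix-vector product. *)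

theory Defs
  imports "HOL-Analysis.Analysis"
begin

section \<open>C^1 maps on open subsets of R^l\<close>

definition C1_on :: "(real^'l) set \<Rightarrow> (real^'l \<Rightarrow> real^'l) \<Rightarrow> bool" where
  "C1_on U H \<longleftrightarrow> (\<exists>H' :: (real^'l) \<Rightarrow> ((real^'l) \<Rightarrow>\<^sub>L (real^'l)).
      (\<forall>x\<in>U. (H has_derivative blinfun_apply (H' x)) (at x)) \<and> continuous_on U H')"

section \<open>Compact C^1 submanifolds of R^l\<close>

text \<open>M is an embedded C^1 submanifold of R^l of some dimension d: around every point of M there
  is a C^1 diffeomorphism (straightening chart) of open sets of R^l carrying M onto a
  d-dimensional linear subspace.\<close>
definition C1_submanifold :: "(real^'l) set \<Rightarrow> bool" where
  "C1_submanifold M \<longleftrightarrow> (\<exists>d::nat. \<forall>x\<in>M. \<exists>U V (\<phi>::real^'l \<Rightarrow> real^'l) \<psi> S.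
      open U \<and> x \<in> U \<and> open V \<and> homeomorphism U V \<phi> \<psi> \<and> C1_on U \<phi> \<and> C1_on V \<psi> \<and>
      subspace S \<and> dim S = d \<and> \<phi> ` (U \<inter> M) = V \<inter> S)"

definition compact_manifold :: "(real^'l) set \<Rightarrow> bool" where
  "compact_manifold M \<longleftrightarrow> compact M \<and> C1_submanifold M"

section \<open>Tangent spaces, C^1 maps on M, derivative norms, C^1 norm\<close>

definition tangent_space :: "(real^'l) set \<Rightarrow> real^'l \<Rightarrow> (real^'l) set" where
  "tangent_space M x = {v. \<exists>(\<gamma>::real \<Rightarrow> real^'l) e. e > 0 \<and> (\<forall>t\<in>{-e<..<e}. \<gamma> t \<in> M) \<and>
      \<gamma> 0 = x \<and> (\<gamma> has_vector_derivative v) (at 0)}"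

text \<open>A map h : M \<rightarrow> R^l is C^1 if it is the restriction of a C^1 map on an open neighbourhood of M.\<close>
definition C1_map_on :: "(real^'l) set \<Rightarrow> (real^'l \<Rightarrow> real^'l) \<Rightarrow> bool" where
  "C1_map_on M h \<longleftrightarrow> (\<exists>U H. open U \<and> M \<subseteq> U \<and> C1_on U H \<and> (\<forall>x\<in>M. H x = h x))"

text \<open>The operator norm of D_x h : T_x M \<rightarrow> R^l (a derivative of h at x within M is
  determined on T_x M).\<close>
definition deriv_norm :: "(real^'l) set \<Rightarrow> (real^'l \<Rightarrow> real^'l) \<Rightarrow> real^'l \<Rightarrow> real" where
  "deriv_norm M h x =
     (let h' = (SOME h'. (h has_derivative h') (at x within M))
      in Sup ((\<lambda>v. norm (h' v)) ` {v \<in> tangent_space M x. norm v \<le> 1}))"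

text \<open>\<parallel>h\<parallel>_1 = sup_{x \<in> M} (\<parallel>h x\<parallel> + \<parallel>D_x h\<parallel>).\<close>
definition C1_norm :: "(real^'l) set \<Rightarrow> (real^'l \<Rightarrow> real^'l) \<Rightarrow> real" where
  "C1_norm M h = Sup ((\<lambda>x. norm (h x) + deriv_norm M h x) ` M)"

text \<open>d(h, id) = \<parallel>h - id\<parallel>_1.\<close>
definition dist_C1_id :: "(real^'l) set \<Rightarrow> (real^'l \<Rightarrow> real^'l) \<Rightarrow> real" where
  "dist_C1_id M h = C1_norm M (\<lambda>x. h x - x)"

section \<open>Diff^1(M) and the action of Gamma_A\<close>

definition C1_diffeo_on :: "(real^'l) set \<Rightarrow> (real^'l \<Rightarrow> real^'l) \<Rightarrow> bool" where
  "C1_diffeo_on M h \<longleftrightarrow> bij_betw h M M \<and> C1_map_on M h \<and> C1_map_on M (inv_into M h)"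

text \<open>Integer powers of a bijection of M (as maps on M).\<close>
definition ipow :: "(real^'l) set \<Rightarrow> (real^'l \<Rightarrow> real^'l) \<Rightarrow> int \<Rightarrow> real^'l \<Rightarrow> real^'l" where
  "ipow M h m = (if m \<ge> 0 then h ^^ nat m else (inv_into M h) ^^ nat (- m))"

text \<open>A C^1 action \<rho> of
  Gamma_A = < a, b_1..b_n | b_i b_j = b_j b_i, a b_i a^-1 = prod_j b_j^(A_ij) >
  on M, given by f = \<rho>(a) and g i = \<rho>(b_i): the images of the generators are
  C^1 diffeomorphisms of M satisfying the defining relations (as maps on M).
  Since the g j commute, the product prod_j g_j^(A_ij) does not depend on the order;
  we require the relation for every enumeration of the index type.\<close>
definition GammaA_action ::
  "(real^'l) set \<Rightarrow> int^'n^'n \<Rightarrow> (real^'l \<Rightarrow> real^'l) \<Rightarrow> ('n \<Rightarrow> real^'l \<Rightarrow> real^'l) \<Rightarrow> bool" where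
  "GammaA_action M A f g \<longleftrightarrow>
     C1_diffeo_on M f \<and> (\<forall>i. C1_diffeo_on M (g i)) \<and>
     (\<forall>i j. \<forall>x\<in>M. g i (g j x) = g j (g i x)) \<and>
     (\<forall>i xs. distinct xs \<and> set xs = UNIV \<longrightarrow>
        (\<forall>x\<in>M. f (g i (inv_into M f x)) = foldr (\<lambda>j acc. ipow M (g j) (A $ i $ j) \<circ> acc) xs id x))"

text \<open>d_{C^1}(\<rho>, id).\<close>
definition dist_C1_action ::
  "(real^'l) set \<Rightarrow> (real^'l \<Rightarrow> real^'l) \<Rightarrow> ('n::finite \<Rightarrow> real^'l \<Rightarrow> real^'l) \<Rightarrow> real" where
  "dist_C1_action M f g = max (dist_C1_id M f) (Max (range (\<lambda>i. dist_C1_id M (g i))))"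

section \<open>Displacement matrix\<close>

text \<open>D(x): n \<times> l matrix whose i-th row is G_i(x) = g_i(x) - x.\<close>
definition displacement :: "('n \<Rightarrow> real^'l \<Rightarrow> real^'l) \<Rightarrow> real^'l \<Rightarrow> real^'l^'n" where
  "displacement g x = (\<chi> i. g i x - x)"

definition column :: "real^'l^'n \<Rightarrow> 'l \<Rightarrow> real^'n" where
  "column D j = (\<chi> i. D $ i $ j)"

definition mat_pow :: "real^'n^'n \<Rightarrow> nat \<Rightarrow> real^'n^'n" where
  "mat_pow B k = ((\<lambda>C. B ** C) ^^ k) (mat 1)"

end

theory Submission
  imports Defs
begin

text \<open>
  Write G_i(x) = g_i(x) - x for the displacements of the generators and max_disp(x) for
  max_i |G_i(x)|. The proof combines a geometric and an algebraic ingredient.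

  Geometry. A compact C^1 submanifold is uniformly quasi-convex at small scales: points closer
  than \<delta> are joined in M by paths whose tangent speed is at most C times their distance
  (compact_manifold_joins). The mean value inequality along such paths shows that a map \<phi>
  with d(\<phi>, id) \<le> \<epsilon> moves points by at most \<epsilon> and has C \<epsilon>-Lipschitz displacement at
  scales below \<delta> (displacement_controlled_by_C1_dist).

  Algebra. If the generators are \<epsilon>-close to the identity with c-Lipschitz displacements,
  c \<le> 1/2, then every word w = \<Prod>_j g_j^(r_j) is linearly approximated: w z - z agrees with
  \<Sum>_j r_j G_j(z) up to N c max_disp(z) (locale near_identity_family, linear_approx).
  Applying the relation f g_i f^(-1) = \<Prod>_j g_j^(A_ij) at z and using that f is also close to
  the identity gives D(z) = A D(f z) up to O(c max_disp(f z)) columnwise (one_step). Iterating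
  k times (column_orbit) and choosing \<epsilon> small yields the theorem.

  The sections follow this plan: tangent vectors and the C^1 norm, short tangent paths,
  elementary estimates and constants, the linear approximation of words, near-identity actions
  of Gamma_A, and finally the choice of \<epsilon>.
\<close>

section \<open>Tangent vectors\<close>

text \<open>The velocity of a curve that stays in M near time s is a tangent vector of M.\<close>
lemma path_velocity_in_tangent_space:
  fixes p :: "real \<Rightarrow> real^'l"
  assumes der: "(p has_vector_derivative v) (at s)"
    and e: "e > 0" and inM: "\<And>t. \<bar>t - s\<bar> < e \<Longrightarrow> p t \<in> M"
  shows "v \<in> tangent_space M (p s)"
proof -
  have shift: "((\<lambda>t. s + t) has_vector_derivative 1) (at 0)"
    by (auto intro!: derivative_eq_intros)
  have "((p \<circ> (\<lambda>t. s + t)) has_vector_derivative (1 *\<^sub>R v)) (at 0)"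
    using vector_diff_chain_at[OF shift] der by simp
  moreover have "\<forall>t\<in>{-e<..<e}. (p \<circ> (\<lambda>t. s + t)) t \<in> M"
    using inM by auto
  ultimately show ?thesis
    unfolding tangent_space_def using e by (intro CollectI exI[of _ "p \<circ> (\<lambda>t. s + t)"] exI[of _ e]) auto
qed

text \<open>The zero vector is tangent at every point of M (constant curve).\<close>
lemma tangent_space_zero:
  fixes M :: "(real^'l) set"
  assumes "x \<in> M"
  shows "0 \<in> tangent_space M x"
  using path_velocity_in_tangent_space[of "\<lambda>t. x" 0 0 1 M] assms by auto

text \<open>Tangent spaces are closed under scaling (reparametrise the curve linearly).\<close>
lemma tangent_space_scaleR:
  fixes M :: "(real^'l) set"
  assumes "v \<in> tangent_space M x"
  shows "c *\<^sub>R v \<in> tangent_space M x"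
proof -
  obtain \<gamma> :: "real \<Rightarrow> real^'l" and e where \<gamma>: "e > 0" "\<forall>t\<in>{-e<..<e}. \<gamma> t \<in> M" "\<gamma> 0 = x"
    "(\<gamma> has_vector_derivative v) (at 0)"
    using assms unfolding tangent_space_def by blast
  define e' where "e' = e / (\<bar>c\<bar> + 1)"
  have "e' > 0" using \<gamma>(1) by (simp add: e'_def)
  have lin: "((\<lambda>t. c * t) has_vector_derivative c) (at 0)"
    using has_vector_derivative_real_field[of "(*) c" c 0 UNIV] by simp
  have "((\<gamma> \<circ> (\<lambda>t. c * t)) has_vector_derivative (c *\<^sub>R v)) (at 0)"
    using vector_diff_chain_at[OF lin] \<gamma>(4) by simp
  moreover have "(\<gamma> \<circ> (\<lambda>t. c * t)) t \<in> M" if "\<bar>t - 0\<bar> < e'" for t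
  proof -
    have "\<bar>c * t\<bar> \<le> (\<bar>c\<bar> + 1) * \<bar>t\<bar>" by (simp add: abs_mult mult_right_mono)
    also have "\<dots> < e" using that \<gamma>(1) by (simp add: e'_def field_simps)
    finally show ?thesis using \<gamma>(2) by (auto simp: abs_less_iff)
  qed
  ultimately have "c *\<^sub>R v \<in> tangent_space M ((\<gamma> \<circ> (\<lambda>t. c * t)) 0)"
    by (rule path_velocity_in_tangent_space[OF _ \<open>e' > 0\<close>])
  then show ?thesis using \<gamma>(3) by simp
qed

text \<open>Two derivatives of h within M agree on tangent vectors, by the chain rule along a curve.\<close>
lemma tangent_derivative_unique:
  fixes M :: "(real^'l) set" and h :: "real^'l \<Rightarrow> 'b::real_normed_vector"
  assumes h1: "(h has_derivative h1) (at x within M)" and h2: "(h has_derivative h2) (at x within M)"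
    and v: "v \<in> tangent_space M x"
  shows "h1 v = h2 v"
proof -
  obtain \<gamma> :: "real \<Rightarrow> real^'l" and e where \<gamma>: "e > 0" "\<forall>t\<in>{-e<..<e}. \<gamma> t \<in> M" "\<gamma> 0 = x"
    "(\<gamma> has_vector_derivative v) (at 0)"
    using v unfolding tangent_space_def by blast
  let ?I = "{-e<..<e}"
  have sub: "\<gamma> ` ?I \<subseteq> M" using \<gamma>(2) by auto
  have \<gamma>I: "(\<gamma> has_vector_derivative v) (at 0 within ?I)"
    using \<gamma>(4) has_vector_derivative_at_within by blast
  have I: "0 \<in> ?I" "open ?I" using \<gamma>(1) by auto
  have chain: "((h \<circ> \<gamma>) has_vector_derivative h' v) (at 0)"
    if "(h has_derivative h') (at x within M)" for h'
  proof -
    have "(h has_derivative h') (at (\<gamma> 0) within \<gamma> ` ?I)"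
      using has_derivative_subset[OF that sub] \<gamma>(3) by simp
    from vector_derivative_diff_chain_within[OF \<gamma>I this]
    show ?thesis using has_vector_derivative_within_open I by blast
  qed
  show ?thesis using chain[OF h1] chain[OF h2] vector_derivative_unique_at by blast
qed

section \<open>The C^1 distance to the identity\<close>

text \<open>The displacement h x - x of a C^1 map is again C^1 on M.\<close>
lemma C1_map_on_minus_id:
  fixes M :: "(real^'l) set"
  assumes "C1_map_on M h"
  shows "C1_map_on M (\<lambda>x. h x - x)"
proof -
  obtain U H where U: "open U" "M \<subseteq> U" "C1_on U H" "\<forall>x\<in>M. H x = h x"
    using assms unfolding C1_map_on_def by blast
  obtain H' where H': "\<forall>x\<in>U. (H has_derivative blinfun_apply (H' x)) (at x)" "continuous_on U H'"
    using U(3) unfolding C1_on_def by blast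
  have "((\<lambda>x. H x - x) has_derivative blinfun_apply (H' x - id_blinfun)) (at x)" if "x \<in> U" for x
  proof -
    have "((\<lambda>x. H x - x) has_derivative (\<lambda>v. H' x v - v)) (at x)"
      using H'(1) that by (auto intro!: derivative_eq_intros)
    moreover have "blinfun_apply (H' x - id_blinfun) = (\<lambda>v. H' x v - v)"
      by (rule ext) (simp add: blinfun.diff_left)
    ultimately show ?thesis by simp
  qed
  moreover have "continuous_on U (\<lambda>x. H' x - id_blinfun)"
    using H'(2) by (intro continuous_intros)
  ultimately have "C1_on U (\<lambda>x. H x - x)"
    unfolding C1_on_def by (intro exI[of _ "\<lambda>x. H' x - id_blinfun"]) auto
  then show ?thesis
    unfolding C1_map_on_def using U by (intro exI[of _ U] exI[of _ "\<lambda>x. H x - x"]) auto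
qed

text \<open>A C^1 map on M has, at every point of M, a derivative within M depending continuously
  on the point.\<close>
lemma C1_map_on_derivative:
  fixes M :: "(real^'l) set"
  assumes "C1_map_on M h"
  obtains H' :: "real^'l \<Rightarrow> ((real^'l) \<Rightarrow>\<^sub>L (real^'l))"
  where "\<And>x. x \<in> M \<Longrightarrow> (h has_derivative blinfun_apply (H' x)) (at x within M)"
    and "continuous_on M H'" and "continuous_on M h"
proof -
  obtain U H where U: "open U" "M \<subseteq> U" "C1_on U H" "\<forall>x\<in>M. H x = h x"
    using assms unfolding C1_map_on_def by blast
  obtain H' where H': "\<forall>x\<in>U. (H has_derivative blinfun_apply (H' x)) (at x)" "continuous_on U H'"
    using U(3) unfolding C1_on_def by blast
  have der: "(h has_derivative blinfun_apply (H' x)) (at x within M)" if "x \<in> M" for x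
  proof -
    have "(H has_derivative blinfun_apply (H' x)) (at x within M)"
      using H'(1) U(2) that has_derivative_at_withinI by blast
    then show ?thesis
      by (rule has_derivative_transform_within[where d=1]) (use that U(4) in auto)
  qed
  moreover have "continuous_on M H'" using H'(2) U(2) by (rule continuous_on_subset)
  moreover have "continuous_on M h" using der by (intro has_derivative_continuous_on) blast
  ultimately show ?thesis by (rule that)
qed

text \<open>The SOME-chosen derivative in the definition of deriv_norm may be replaced by any
  derivative within M, since derivatives within M agree on tangent vectors.\<close>
lemma deriv_norm_eq:
  fixes M :: "(real^'l) set"
  assumes "(h has_derivative blinfun_apply L) (at x within M)"
  shows "deriv_norm M h x = Sup ((\<lambda>v. norm (L v)) ` {v \<in> tangent_space M x. norm v \<le> 1})"
proof -
  let ?h = "SOME h'. (h has_derivative h') (at x within M)"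
  have "(h has_derivative ?h) (at x within M)" by (rule someI[where x="blinfun_apply L"]) (rule assms)
  then have "?h v = L v" if "v \<in> tangent_space M x" for v
    using tangent_derivative_unique assms that by blast
  then show ?thesis unfolding deriv_norm_def Let_def
    by (intro arg_cong[where f=Sup] image_cong) auto
qed

text \<open>The derivative norm is non-negative, bounded by the operator norm of any derivative, and
  bounds the derivative on all tangent vectors.\<close>
lemma deriv_norm_bounds:
  fixes M :: "(real^'l) set"
  assumes der: "(h has_derivative blinfun_apply L) (at x within M)" and x: "x \<in> M"
  shows "0 \<le> deriv_norm M h x" and "deriv_norm M h x \<le> norm L"
    and "\<And>v. v \<in> tangent_space M x \<Longrightarrow> norm (L v) \<le> deriv_norm M h x * norm v"
proof -
  define T1 where "T1 = {v \<in> tangent_space M x. norm v \<le> 1}"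
  have dn: "deriv_norm M h x = Sup ((\<lambda>v. norm (L v)) ` T1)"
    unfolding T1_def by (rule deriv_norm_eq[OF der])
  have zero: "0 \<in> T1" unfolding T1_def using tangent_space_zero[OF x] by simp
  have le_L: "norm (L v) \<le> norm L" if "v \<in> T1" for v
    using norm_blinfun[of L v] that mult_left_le[of "norm v" "norm L"] unfolding T1_def by auto
  have upper: "norm (L v) \<le> deriv_norm M h x" if "v \<in> T1" for v
    unfolding dn using le_L that by (intro cSup_upper bdd_aboveI2) auto
  show "0 \<le> deriv_norm M h x" using upper[OF zero] by simp
  show "deriv_norm M h x \<le> norm L" unfolding dn using zero le_L by (intro cSup_least) auto
  show "norm (L v) \<le> deriv_norm M h x * norm v" if v: "v \<in> tangent_space M x" for v
  proof (cases "v = 0")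
    case False
    have "(1 / norm v) *\<^sub>R v \<in> T1"
      unfolding T1_def using tangent_space_scaleR[OF v] False by simp
    moreover have "norm (L ((1 / norm v) *\<^sub>R v)) = norm (L v) / norm v"
      by (simp add: blinfun.scaleR_right)
    ultimately have "norm (L v) / norm v \<le> deriv_norm M h x" using upper by metis
    then show ?thesis using False by (simp add: divide_le_eq)
  qed simp
qed

text \<open>On a compact M the C^1 norm is a finite supremum, so it bounds the value and the
  tangential derivative of h at every point.\<close>
lemma C1_norm_upper:
  fixes M :: "(real^'l) set"
  assumes M: "compact M" and h: "C1_map_on M h" and w: "w \<in> M"
  shows "norm (h w) + deriv_norm M h w \<le> C1_norm M h"
proof -
  obtain H' where der: "\<And>x. x \<in> M \<Longrightarrow> (h has_derivative blinfun_apply (H' x)) (at x within M)"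
    and "continuous_on M H'" "continuous_on M h"
    using C1_map_on_derivative[OF h] by blast
  then obtain B1 B2 where B1: "\<And>x. x \<in> M \<Longrightarrow> norm (H' x) \<le> B1"
    and B2: "\<And>x. x \<in> M \<Longrightarrow> norm (h x) \<le> B2"
    using continuous_on_compact_bound[OF M] by metis
  have "norm (h x) + deriv_norm M h x \<le> B2 + B1" if "x \<in> M" for x
    using B1[OF that] B2[OF that] deriv_norm_bounds(2)[OF der[OF that] that] by linarith
  then have "bdd_above ((\<lambda>x. norm (h x) + deriv_norm M h x) ` M)"
    by (intro bdd_aboveI2)
  then show ?thesis unfolding C1_norm_def using w by (intro cSup_upper) auto
qed

text \<open>Consequently the C^1 norm bounds |h w| and the tangential derivative of h at w.\<close>
lemma C1_norm_controls:
  fixes M :: "(real^'l) set"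
  assumes M: "compact M" and h: "C1_map_on M h" and w: "w \<in> M"
  shows "norm (h w) \<le> C1_norm M h"
    and "\<exists>h'. (h has_derivative h') (at w within M) \<and>
               (\<forall>v\<in>tangent_space M w. norm (h' v) \<le> C1_norm M h * norm v)"
proof -
  obtain H' where der: "(h has_derivative blinfun_apply (H' w)) (at w within M)"
    using C1_map_on_derivative[OF h] w by metis
  note upper = C1_norm_upper[OF M h w] and dn = deriv_norm_bounds[OF der w]
  show "norm (h w) \<le> C1_norm M h" using upper dn(1) by linarith
  have "norm (H' w v) \<le> C1_norm M h * norm v" if "v \<in> tangent_space M w" for v
  proof -
    have "deriv_norm M h w \<le> C1_norm M h" using upper norm_ge_zero[of "h w"] by linarith
    then show ?thesis using dn(3)[OF that] mult_right_mono[of _ _ "norm v"] by force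
  qed
  then show "\<exists>h'. (h has_derivative h') (at w within M) \<and>
               (\<forall>v\<in>tangent_space M w. norm (h' v) \<le> C1_norm M h * norm v)"
    using der by blast
qed

section \<open>Short tangent paths in a compact submanifold\<close>

text \<open>x and z are joined in M by a path whose velocity is tangent to M and of norm at most \<sigma>.\<close>
definition joined_in :: "(real^'l) set \<Rightarrow> real^'l \<Rightarrow> real^'l \<Rightarrow> real \<Rightarrow> bool" where
  "joined_in M x z \<sigma> \<longleftrightarrow> (\<exists>p p'. p 0 = x \<and> p 1 = z \<and> continuous_on {0..1} p \<and> p ` {0..1} \<subseteq> M \<and>
     (\<forall>s\<in>{0<..<1}. (p has_vector_derivative p' s) (at s) \<and> p' s \<in> tangent_space M (p s) \<and>
        norm (p' s) \<le> \<sigma>))"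

text \<open>Paths of speed at most \<sigma> also have speed at most any \<sigma>' \<ge> \<sigma>.\<close>
lemma joined_in_mono:
  assumes "joined_in M x z \<sigma>" "\<sigma> \<le> \<sigma>'"
  shows "joined_in M x z \<sigma>'"
proof -
  obtain p p' where "p 0 = x \<and> p 1 = z \<and> continuous_on {0..1} p \<and> p ` {0..1} \<subseteq> M \<and>
     (\<forall>s\<in>{0<..<1}. (p has_vector_derivative p' s) (at s) \<and> p' s \<in> tangent_space M (p s) \<and>
        norm (p' s) \<le> \<sigma>)"
    using assms(1) unfolding joined_in_def by blast
  then show ?thesis
    unfolding joined_in_def using assms(2) by (intro exI[of _ p] exI[of _ p']) auto
qed

text \<open>A continuous path in M, differentiable on the open interval with speed at most \<sigma>, joins
  its endpoints: its velocity is automatically tangent to M.\<close>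
lemma joined_in_intro:
  fixes p p' :: "real \<Rightarrow> real^'l"
  assumes cont: "continuous_on {0..1} p" and img: "p ` {0..1} \<subseteq> M"
    and der: "\<And>s. s \<in> {0<..<1} \<Longrightarrow> (p has_vector_derivative p' s) (at s)"
    and speed: "\<And>s. s \<in> {0<..<1} \<Longrightarrow> norm (p' s) \<le> \<sigma>"
  shows "joined_in M (p 0) (p 1) \<sigma>"
proof -
  have "p' s \<in> tangent_space M (p s)" if s: "s \<in> {0<..<1}" for s
  proof (rule path_velocity_in_tangent_space[where e="min s (1 - s)"])
    show "(p has_vector_derivative p' s) (at s)" using der[OF s] .
    show "p t \<in> M" if "\<bar>t - s\<bar> < min s (1 - s)" for t
    proof -
      have "t \<in> {0..1}" using that by (auto simp: abs_less_iff)
      then show ?thesis using img by blast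
    qed
  qed (use s in auto)
  then show ?thesis
    unfolding joined_in_def using cont img der speed by (intro exI[of _ p] exI[of _ p']) auto
qed

text \<open>Mean value inequality along a path of tangent speed at most \<sigma>: a map whose tangential
  derivative is bounded by B moves the endpoints apart by at most B \<sigma>.\<close>
lemma joined_in_lipschitz:
  fixes M :: "(real^'l) set" and h :: "real^'l \<Rightarrow> real^'l"
  assumes "joined_in M x z \<sigma>" and B: "B \<ge> 0"
    and hder: "\<And>w. w \<in> M \<Longrightarrow> \<exists>h'. (h has_derivative h') (at w within M) \<and>
                 (\<forall>v\<in>tangent_space M w. norm (h' v) \<le> B * norm v)"
  shows "norm (h z - h x) \<le> B * \<sigma>"
proof -
  obtain p p' where p: "p 0 = x" "p 1 = z" "continuous_on {0..1} p" "p ` {0..1} \<subseteq> M"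
    and p': "\<And>s. s \<in> {0<..<1} \<Longrightarrow> (p has_vector_derivative p' s) (at s) \<and>
               p' s \<in> tangent_space M (p s) \<and> norm (p' s) \<le> \<sigma>"
    using assms(1) unfolding joined_in_def by blast
  obtain hh where hh: "\<And>w. w \<in> M \<Longrightarrow> (h has_derivative hh w) (at w within M) \<and>
                 (\<forall>v\<in>tangent_space M w. norm (hh w v) \<le> B * norm v)"
    using hder by metis
  have "continuous_on M h" using hh by (intro has_derivative_continuous_on) blast
  then have cont: "continuous_on {0..1} (h \<circ> p)"
    using p(3,4) by (intro continuous_on_compose) (auto intro: continuous_on_subset)
  have der: "((h \<circ> p) has_derivative (\<lambda>t. t *\<^sub>R hh (p s) (p' s))) (at s)"
    if "0 < s" "s < 1" for s
  proof -
    let ?I = "{0<..<1::real}"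
    have sI: "s \<in> ?I" using that by auto
    have sub: "p ` ?I \<subseteq> M" using p(4) by auto
    have "(p has_vector_derivative p' s) (at s within ?I)"
      using p'[OF sI] has_vector_derivative_at_within by blast
    moreover have "(h has_derivative hh (p s)) (at (p s) within p ` ?I)"
      using hh sub sI has_derivative_subset by blast
    ultimately have "((h \<circ> p) has_vector_derivative hh (p s) (p' s)) (at s within ?I)"
      by (rule vector_derivative_diff_chain_within)
    then have "((h \<circ> p) has_vector_derivative hh (p s) (p' s)) (at s)"
      by (metis has_vector_derivative_within_open open_greaterThanLessThan sI)
    then show ?thesis unfolding has_vector_derivative_def .
  qed
  obtain s where s: "s \<in> {0<..<1}"
    and mvt: "norm ((h \<circ> p) 1 - (h \<circ> p) 0) \<le> norm ((1 - 0) *\<^sub>R hh (p s) (p' s))"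
    using mvt_general[OF zero_less_one cont der] by blast
  have "p s \<in> M" using p(4) s by auto
  then have "norm (hh (p s) (p' s)) \<le> B * norm (p' s)" using hh p'[OF s] by blast
  also have "\<dots> \<le> B * \<sigma>" using p'[OF s] B by (intro mult_left_mono) auto
  finally show ?thesis using mvt p(1,2) by simp
qed

text \<open>A C^1 map has, near each point of its open domain, a derivative of bounded norm on a
  closed ball, hence is Lipschitz there.\<close>
lemma C1_on_local_bound:
  assumes "C1_on U \<phi>" "open U" "x0 \<in> U"
  obtains r L \<Phi>' where "r > 0" "cball x0 r \<subseteq> U" "L \<ge> 0"
    and "\<And>y. y \<in> cball x0 r \<Longrightarrow> (\<phi> has_derivative blinfun_apply (\<Phi>' y)) (at y) \<and> norm (\<Phi>' y) \<le> L"
proof -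
  obtain \<Phi>' where \<Phi>': "\<forall>x\<in>U. (\<phi> has_derivative blinfun_apply (\<Phi>' x)) (at x)" "continuous_on U \<Phi>'"
    using assms(1) unfolding C1_on_def by blast
  obtain r where r: "r > 0" "cball x0 r \<subseteq> U" using assms(2,3) open_contains_cball by blast
  obtain L where L: "L \<ge> 0" "\<And>y. y \<in> cball x0 r \<Longrightarrow> norm (\<Phi>' y) \<le> L"
    using continuous_on_compact_bound[OF compact_cball continuous_on_subset[OF \<Phi>'(2) r(2)]] by blast
  show ?thesis
  proof (rule that[OF r L(1)])
    show "(\<phi> has_derivative blinfun_apply (\<Phi>' y)) (at y) \<and> norm (\<Phi>' y) \<le> L"
      if "y \<in> cball x0 r" for y
      using \<Phi>'(1) r(2) L(2) that by blast
  qed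
qed

text \<open>In particular a C^1 map is Lipschitz on a small closed ball (mean value inequality).\<close>
lemma C1_on_local_lipschitz:
  assumes "C1_on U \<phi>" "open U" "x0 \<in> U"
  obtains r L where "r > 0" "cball x0 r \<subseteq> U" "L \<ge> 0"
    and "\<And>x z. x \<in> cball x0 r \<Longrightarrow> z \<in> cball x0 r \<Longrightarrow> norm (\<phi> z - \<phi> x) \<le> L * norm (z - x)"
proof -
  obtain r L \<Phi>' where r: "r > 0" "cball x0 r \<subseteq> U" "L \<ge> 0"
    and \<Phi>': "\<And>y. y \<in> cball x0 r \<Longrightarrow> (\<phi> has_derivative blinfun_apply (\<Phi>' y)) (at y) \<and> norm (\<Phi>' y) \<le> L"
    by (rule C1_on_local_bound[OF assms]) blast
  have lip: "norm (\<phi> z - \<phi> x) \<le> L * norm (z - x)" if "x \<in> cball x0 r" "z \<in> cball x0 r" for x z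
  proof (rule differentiable_bound[where S="cball x0 r" and f'="\<lambda>y. blinfun_apply (\<Phi>' y)"])
    show "(\<phi> has_derivative blinfun_apply (\<Phi>' y)) (at y within cball x0 r)" if "y \<in> cball x0 r" for y
      using \<Phi>' that has_derivative_at_withinI by blast
    show "onorm (blinfun_apply (\<Phi>' y)) \<le> L" if "y \<in> cball x0 r" for y
    proof -
      have "norm (\<Phi>' y) \<le> L" using \<Phi>' that by blast
      then show ?thesis by (simp add: norm_blinfun.rep_eq[symmetric])
    qed
  qed (use that in auto)
  from r lip show ?thesis by (rule that)
qed

text \<open>In a straightening chart, two points of M whose images lie in a convex set K of the
  chart are joined by the preimage of the segment between their images.\<close>
lemma chart_segment_joins:
  fixes M S :: "(real^'l) set" and \<phi> \<psi> :: "real^'l \<Rightarrow> real^'l"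
  assumes hom: "homeomorphism U V \<phi> \<psi>" and chart: "\<phi> ` (U \<inter> M) = V \<inter> S" and S: "subspace S"
    and K: "convex K" "K \<subseteq> V"
    and \<Psi>': "\<And>y. y \<in> K \<Longrightarrow> (\<psi> has_derivative blinfun_apply (\<Psi>' y)) (at y) \<and> norm (\<Psi>' y) \<le> L"
    and a: "a \<in> K \<inter> S" and b: "b \<in> K \<inter> S"
  shows "joined_in M (\<psi> a) (\<psi> b) (L * norm (b - a))"
proof -
  define q where "q s = a + s *\<^sub>R (b - a)" for s :: real
  have qK: "q s \<in> K" if "s \<in> {0..1}" for s
    using convexD[OF K(1), of a b "1 - s" s] a b that by (auto simp: q_def algebra_simps)
  have qS: "q s \<in> S" for s
    unfolding q_def using a b S by (intro subspace_add subspace_scale subspace_diff) auto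
  have pM: "\<psi> (q s) \<in> M" if "s \<in> {0..1}" for s
  proof -
    have "q s \<in> \<phi> ` (U \<inter> M)" using chart qK[OF that] K(2) qS by auto
    then show ?thesis using hom by (auto simp: homeomorphism_def)
  qed
  define p' where "p' s = \<Psi>' (q s) (b - a)" for s
  have pd: "((\<psi> \<circ> q) has_vector_derivative p' s) (at s)" if "s \<in> {0..1}" for s
  proof -
    have "(q has_vector_derivative (b - a)) (at s)"
      unfolding q_def by (auto intro!: derivative_eq_intros)
    moreover have "(\<psi> has_derivative blinfun_apply (\<Psi>' (q s))) (at (q s) within range q)"
      using \<Psi>' qK[OF that] has_derivative_at_withinI by blast
    ultimately show ?thesis
      unfolding p'_def using vector_derivative_diff_chain_within has_vector_derivative_at_within by blast
  qed
  have "continuous_on {0..1} (\<psi> \<circ> q)"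
  proof (rule continuous_on_compose)
    show "continuous_on {0..1} q" unfolding q_def by (intro continuous_intros)
    have "continuous_on V \<psi>" using hom by (simp add: homeomorphism_def)
    then show "continuous_on (q ` {0..1}) \<psi>"
      by (rule continuous_on_subset) (use qK K(2) in auto)
  qed
  moreover have "(\<psi> \<circ> q) ` {0..1} \<subseteq> M" using pM by auto
  moreover have "norm (p' s) \<le> L * norm (b - a)" if "s \<in> {0..1}" for s
    unfolding p'_def using norm_blinfun[of "\<Psi>' (q s)" "b - a"] \<Psi>'[OF qK[OF that]]
    by (meson mult_right_mono norm_ge_zero order_trans)
  ultimately have "joined_in M ((\<psi> \<circ> q) 0) ((\<psi> \<circ> q) 1) (L * norm (b - a))"
    using pd by (intro joined_in_intro[where p'=p']) (auto simp: comp_def)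
  then show ?thesis by (simp add: q_def)
qed

text \<open>Near a point of M covered by a straightening chart, nearby points of M are joined by
  paths whose speed is proportional to their distance.\<close>
lemma chart_local_joins:
  fixes M S :: "(real^'l) set" and \<phi> \<psi> :: "real^'l \<Rightarrow> real^'l"
  assumes U: "open U" "x0 \<in> U" and V: "open V" and hom: "homeomorphism U V \<phi> \<psi>"
    and \<phi>C1: "C1_on U \<phi>" and \<psi>C1: "C1_on V \<psi>" and S: "subspace S" and chart: "\<phi> ` (U \<inter> M) = V \<inter> S"
  shows "\<exists>r>0. \<exists>C\<ge>0. \<forall>x\<in>M \<inter> ball x0 r. \<forall>z\<in>M \<inter> ball x0 r. joined_in M x z (C * norm (z - x))"
proof -
  have inv: "\<And>x. x \<in> U \<Longrightarrow> \<psi> (\<phi> x) = x" and "\<phi> x0 \<in> V" and "continuous_on U \<phi>"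
    using hom U(2) by (auto simp: homeomorphism_def)
  obtain \<rho> L2 \<Psi>' where \<rho>: "\<rho> > 0" "cball (\<phi> x0) \<rho> \<subseteq> V" "L2 \<ge> 0"
    and \<Psi>': "\<And>y. y \<in> cball (\<phi> x0) \<rho> \<Longrightarrow> (\<psi> has_derivative blinfun_apply (\<Psi>' y)) (at y) \<and> norm (\<Psi>' y) \<le> L2"
    by (rule C1_on_local_bound[OF \<psi>C1 V \<open>\<phi> x0 \<in> V\<close>]) blast
  obtain r2 L1 where r2: "r2 > 0" "cball x0 r2 \<subseteq> U" "L1 \<ge> 0"
    and lip: "\<And>x z. x \<in> cball x0 r2 \<Longrightarrow> z \<in> cball x0 r2 \<Longrightarrow> norm (\<phi> z - \<phi> x) \<le> L1 * norm (z - x)"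
    by (rule C1_on_local_lipschitz[OF \<phi>C1 U]) blast
  have "isCont \<phi> x0" using \<open>continuous_on U \<phi>\<close> U continuous_on_eq_continuous_at by blast
  then obtain r1 where r1: "r1 > 0" "\<And>x. dist x x0 < r1 \<Longrightarrow> dist (\<phi> x) (\<phi> x0) < \<rho>"
    unfolding continuous_at_eps_delta using \<rho>(1) by blast
  define r where "r = min r1 r2"
  have "\<forall>x\<in>M \<inter> ball x0 r. \<forall>z\<in>M \<inter> ball x0 r. joined_in M x z (L2 * L1 * norm (z - x))"
  proof (intro ballI)
    fix x z assume x: "x \<in> M \<inter> ball x0 r" and z: "z \<in> M \<inter> ball x0 r"
    have xz: "x \<in> cball x0 r2" "z \<in> cball x0 r2" using x z by (auto simp: r_def dist_commute)
    have "x \<in> U \<inter> M" "z \<in> U \<inter> M" using x z xz r2(2) by auto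
    then have "\<phi> x \<in> V \<inter> S" "\<phi> z \<in> V \<inter> S" using chart by blast+
    moreover have "dist (\<phi> x) (\<phi> x0) < \<rho>" "dist (\<phi> z) (\<phi> x0) < \<rho>"
      using r1(2)[of x] r1(2)[of z] x z by (simp_all add: r_def dist_commute)
    then have "\<phi> x \<in> cball (\<phi> x0) \<rho>" "\<phi> z \<in> cball (\<phi> x0) \<rho>"
      by (auto simp: dist_commute)
    ultimately have "joined_in M (\<psi> (\<phi> x)) (\<psi> (\<phi> z)) (L2 * norm (\<phi> z - \<phi> x))"
      using chart_segment_joins[OF hom chart S convex_cball \<rho>(2) \<Psi>'] by blast
    moreover have "L2 * norm (\<phi> z - \<phi> x) \<le> L2 * L1 * norm (z - x)"
      using lip[OF xz] \<rho>(3) by (simp add: mult.assoc mult_left_mono)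
    moreover have "\<psi> (\<phi> x) = x" "\<psi> (\<phi> z) = z" using inv xz r2(2) by auto
    ultimately show "joined_in M x z (L2 * L1 * norm (z - x))" by (metis joined_in_mono)
  qed
  moreover have "r > 0" using r1 r2 by (simp add: r_def)
  moreover have "L2 * L1 \<ge> 0" using \<rho>(3) r2(3) by simp
  ultimately show ?thesis by blast
qed

text \<open>Every point of a C^1 submanifold has a neighbourhood in which points of M are joined by
  paths of speed proportional to their distance.\<close>
lemma submanifold_local_joins:
  fixes M :: "(real^'l) set"
  assumes "C1_submanifold M" "x0 \<in> M"
  shows "\<exists>r>0. \<exists>C\<ge>0. \<forall>x\<in>M \<inter> ball x0 r. \<forall>z\<in>M \<inter> ball x0 r. joined_in M x z (C * norm (z - x))"
proof -
  obtain d where "\<forall>x\<in>M. \<exists>U V (\<phi>::real^'l \<Rightarrow> real^'l) \<psi> S.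
    open U \<and> x \<in> U \<and> open V \<and> homeomorphism U V \<phi> \<psi> \<and> C1_on U \<phi> \<and> C1_on V \<psi> \<and>
    subspace S \<and> dim S = d \<and> \<phi> ` (U \<inter> M) = V \<inter> S"
    using assms(1) unfolding C1_submanifold_def by blast
  then obtain U V \<phi> \<psi> S where "open U" "x0 \<in> U" "open V" "homeomorphism U V \<phi> \<psi>"
    "C1_on U \<phi>" "C1_on V \<psi>" "subspace S" "\<phi> ` (U \<inter> M) = V \<inter> S"
    using assms(2) by meson
  then show ?thesis by (rule chart_local_joins)
qed

text \<open>By compactness (a finite subcover and its Lebesgue number) the local statement becomes
  uniform: points of M closer than \<delta> are joined by paths of speed at most C times their
  distance.\<close>
lemma compact_manifold_joins:
  fixes M :: "(real^'l) set"
  assumes "compact_manifold M"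
  obtains \<delta> C where "\<delta> > 0" "C \<ge> 0"
    and "\<And>x z. x \<in> M \<Longrightarrow> z \<in> M \<Longrightarrow> norm (z - x) < \<delta> \<Longrightarrow> joined_in M x z (C * norm (z - x))"
proof -
  have cM: "compact M" and "C1_submanifold M" using assms unfolding compact_manifold_def by auto
  from submanifold_local_joins[OF this(2)]
  have local: "\<forall>x0\<in>M. \<exists>r. r > 0 \<and> (\<exists>C. C \<ge> 0 \<and>
      (\<forall>x\<in>M \<inter> ball x0 r. \<forall>z\<in>M \<inter> ball x0 r. joined_in M x z (C * norm (z - x))))"
    by blast
  obtain r where r: "\<forall>x0\<in>M. r x0 > 0 \<and> (\<exists>C. C \<ge> 0 \<and>
      (\<forall>x\<in>M \<inter> ball x0 (r x0). \<forall>z\<in>M \<inter> ball x0 (r x0). joined_in M x z (C * norm (z - x))))"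
    using bchoice[OF local] by blast
  then have local_r: "\<forall>x0\<in>M. \<exists>C. r x0 > 0 \<and> C \<ge> 0 \<and>
      (\<forall>x\<in>M \<inter> ball x0 (r x0). \<forall>z\<in>M \<inter> ball x0 (r x0). joined_in M x z (C * norm (z - x)))"
    by blast
  obtain C where rC: "\<And>x0. x0 \<in> M \<Longrightarrow> r x0 > 0 \<and> C x0 \<ge> 0 \<and>
      (\<forall>x\<in>M \<inter> ball x0 (r x0). \<forall>z\<in>M \<inter> ball x0 (r x0). joined_in M x z (C x0 * norm (z - x)))"
    using bchoice[OF local_r] by blast
  have "x \<in> ball x (r x)" if "x \<in> M" for x using rC[OF that] by simp
  then have cover: "M \<subseteq> (\<Union>x0\<in>M. ball x0 (r x0))" by blast
  obtain F where F: "F \<subseteq> M" "finite F" "M \<subseteq> (\<Union>x0\<in>F. ball x0 (r x0))"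
    using compactE_image[OF cM _ cover] by blast
  obtain \<delta> where \<delta>: "\<delta> > 0" "\<And>x. x \<in> M \<Longrightarrow> \<exists>G \<in> (\<lambda>x0. ball x0 (r x0)) ` F. ball x \<delta> \<subseteq> G"
    by (rule Heine_Borel_lemma[OF cM F(3)]) auto
  define C0 where "C0 = (\<Sum>x0\<in>F. C x0)"
  have CF: "C x0 \<le> C0" if "x0 \<in> F" for x0
    unfolding C0_def using F rC that by (intro member_le_sum) auto
  have "joined_in M x z (C0 * norm (z - x))" if "x \<in> M" "z \<in> M" "norm (z - x) < \<delta>" for x z
  proof -
    obtain x0 where x0: "x0 \<in> F" "ball x \<delta> \<subseteq> ball x0 (r x0)" using \<delta>(2) \<open>x \<in> M\<close> by blast
    have "x \<in> ball x \<delta>" "z \<in> ball x \<delta>" using \<delta>(1) that(3) by (auto simp: dist_norm norm_minus_commute)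
    then have "x \<in> ball x0 (r x0)" "z \<in> ball x0 (r x0)" using x0(2) by blast+
    then have "joined_in M x z (C x0 * norm (z - x))" using rC x0(1) F(1) that by blast
    moreover have "C x0 * norm (z - x) \<le> C0 * norm (z - x)"
      using CF[OF x0(1)] by (simp add: mult_right_mono)
    ultimately show ?thesis by (rule joined_in_mono)
  qed
  moreover have "C0 \<ge> 0" unfolding C0_def using F rC by (intro sum_nonneg) auto
  ultimately show ?thesis using \<delta>(1) that by blast
qed

text \<open>If d(\<phi>, id) \<le> d, then on a compact manifold the displacement \<phi> x - x is bounded by d
  and, at scales below \<delta>, is C d-Lipschitz (C being the path constant).\<close>
lemma displacement_controlled_by_C1_dist:
  fixes M :: "(real^'l) set"
  assumes cM: "compact M" and \<phi>: "C1_map_on M \<phi>" and C: "C \<ge> 0" and d: "dist_C1_id M \<phi> \<le> d"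
    and joins: "\<And>x z. x \<in> M \<Longrightarrow> z \<in> M \<Longrightarrow> norm (z - x) < \<delta> \<Longrightarrow> joined_in M x z (C * norm (z - x))"
  shows "\<And>w. w \<in> M \<Longrightarrow> norm (\<phi> w - w) \<le> d"
    and "\<And>x z. x \<in> M \<Longrightarrow> z \<in> M \<Longrightarrow> norm (z - x) < \<delta> \<Longrightarrow>
          norm ((\<phi> z - z) - (\<phi> x - x)) \<le> C * d * norm (z - x)"
proof -
  define h where "h x = \<phi> x - x" for x
  have h: "C1_map_on M h" unfolding h_def by (rule C1_map_on_minus_id[OF \<phi>])
  have dist: "C1_norm M h \<le> d" using d unfolding dist_C1_id_def h_def .
  note controls = C1_norm_controls[OF cM h]
  show "norm (\<phi> w - w) \<le> d" if "w \<in> M" for w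
    using controls(1)[OF that] dist unfolding h_def by linarith
  show "norm ((\<phi> z - z) - (\<phi> x - x)) \<le> C * d * norm (z - x)"
    if "x \<in> M" "z \<in> M" "norm (z - x) < \<delta>" for x z
  proof -
    have "0 \<le> C1_norm M h" using controls(1)[OF \<open>x \<in> M\<close>] norm_ge_zero order_trans by blast
    with joins[OF that] have "norm (h z - h x) \<le> C1_norm M h * (C * norm (z - x))"
      using controls(2) by (rule joined_in_lipschitz)
    also have "\<dots> \<le> d * (C * norm (z - x))" using dist C by (simp add: mult_right_mono)
    finally show ?thesis unfolding h_def by (simp add: algebra_simps)
  qed
qed

section \<open>Elementary estimates for vectors and matrices\<close>

text \<open>Absorption: an estimate u \<le> v + c u with c \<le> 1/2 yields u \<le> 2 v.\<close>
lemma le_twice_if_le_plus_half: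
  fixes u v c :: real
  assumes "u \<le> v + c * u" "c \<le> 1/2" "0 \<le> u"
  shows "u \<le> 2 * v"
proof -
  have "c * u \<le> (1/2) * u" using assms(2,3) by (rule mult_right_mono)
  then show ?thesis using assms(1) by linarith
qed

text \<open>Triangle inequality for three summands.\<close>
lemma norm_add3_le:
  fixes x y z :: "'a::real_normed_vector"
  shows "norm (x + y + z) \<le> norm x + norm y + norm z"
  using norm_triangle_ineq[of "x + y" z] norm_triangle_ineq[of x y] by linarith

text \<open>Linear combinations with a Kronecker delta as coefficient vector.\<close>
lemma sum_delta_scaleR:
  fixes v :: "'n::finite \<Rightarrow> 'a::real_vector"
  shows "(\<Sum>i\<in>UNIV. (if i = j then c else 0) *\<^sub>R v i) = c *\<^sub>R v j"
  by (simp add: if_distrib[of "\<lambda>a. a *\<^sub>R _"] sum.delta' cong: if_cong)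

lemma sum_delta_abs:
  fixes j :: "'n::finite"
  shows "(\<Sum>i\<in>UNIV. \<bar>if i = j then c else 0\<bar>) = \<bar>c::real\<bar>"
  by (simp add: if_distrib[of abs] sum.delta' cong: if_cong)

text \<open>A vector of R^n whose entries are bounded by B has norm at most n B.\<close>
lemma norm_le_card_mult_bound:
  fixes v :: "real^'n"
  assumes "\<And>i. \<bar>v $ i\<bar> \<le> B"
  shows "norm v \<le> real CARD('n) * B"
proof -
  have "norm v \<le> (\<Sum>i\<in>UNIV. \<bar>v $ i\<bar>)" by (rule norm_le_l1_cart)
  also have "\<dots> \<le> (\<Sum>i\<in>(UNIV::'n set). B)" using assms by (intro sum_mono)
  finally show ?thesis by simp
qed

text \<open>Bounds by the largest column norm of a matrix.\<close>
lemma column_norm_le_Max: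
  fixes D :: "real^'l^'n"
  shows "norm (column D m) \<le> Max (range (\<lambda>m. norm (column D m)))"
  by (intro Max_ge) auto

text \<open>Each row of an n \<times> l matrix has norm at most l times the largest column norm.\<close>
lemma row_norm_le_columns:
  fixes D :: "real^'l^'n"
  shows "norm (D $ i) \<le> real CARD('l) * Max (range (\<lambda>m. norm (column D m)))"
proof (rule norm_le_card_mult_bound)
  fix m
  have "\<bar>D $ i $ m\<bar> = \<bar>column D m $ i\<bar>" by (simp add: column_def)
  also have "\<dots> \<le> norm (column D m)" by (rule component_le_norm_cart)
  also have "\<dots> \<le> Max (range (\<lambda>m. norm (column D m)))" by (rule column_norm_le_Max)
  finally show "\<bar>D $ i $ m\<bar> \<le> Max (range (\<lambda>m. norm (column D m)))" .
qed

lemma Max_column_norm_nonneg: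
  fixes D :: "real^'l^'n"
  shows "0 \<le> Max (range (\<lambda>m. norm (column D m)))"
  using column_norm_le_Max[of D undefined] norm_ge_zero order_trans by blast

section \<open>Words in the generators and their constants\<close>

text \<open>Constants for the linear approximation of powers and of words in the generators; the
  recursions mirror the composition rule linear_approx_comp below.\<close>
fun iter_const :: "nat \<Rightarrow> real" where
  "iter_const 0 = 0"
| "iter_const (Suc n) = 6 * (iter_const n + 1)"

lemma iter_const_nonneg: "0 \<le> iter_const n"
  by (induction n) auto

lemma iter_const_mono: "iter_const n \<le> iter_const (Suc n)"
  using iter_const_nonneg[of n] by simp

text \<open>The word g_{j1}^{r j1} \<circ> ... \<circ> g_{jm}^{r jm} along the list [j1, ..., jm]; the
  relations of Gamma_A are stated with such words.\<close>
definition gen_word ::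
  "(real^'l) set \<Rightarrow> ('n \<Rightarrow> real^'l \<Rightarrow> real^'l) \<Rightarrow> ('n \<Rightarrow> int) \<Rightarrow> 'n list \<Rightarrow> real^'l \<Rightarrow> real^'l" where
  "gen_word M g r xs = foldr (\<lambda>j acc. ipow M (g j) (r j) \<circ> acc) xs id"

text \<open>A constant for a word along a list: the composition rule applied letter by letter.\<close>
fun word_const :: "('n \<Rightarrow> int) \<Rightarrow> 'n list \<Rightarrow> real" where
  "word_const r [] = 0"
| "word_const r (j # xs) = 2 * (iter_const (nat \<bar>r j\<bar>) + 1) * (word_const r xs + 1)"

lemma word_const_nonneg: "0 \<le> word_const r xs"
  by (induction xs) (auto simp: iter_const_nonneg)

lemma word_const_Cons_ge:
  "word_const r xs \<le> word_const r (j # xs)" "iter_const (nat \<bar>r j\<bar>) \<le> word_const r (j # xs)"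
proof -
  define X where "X = 2 * (iter_const (nat \<bar>r j\<bar>) + 1)"
  have X: "1 \<le> X" "iter_const (nat \<bar>r j\<bar>) \<le> X"
    using iter_const_nonneg[of "nat \<bar>r j\<bar>"] by (simp_all add: X_def)
  have W: "0 \<le> word_const r xs" by (rule word_const_nonneg)
  have eq: "word_const r (j # xs) = X * (word_const r xs + 1)" by (simp add: X_def)
  have A: "word_const r xs + 1 \<le> X * (word_const r xs + 1)"
    using mult_right_mono[OF X(1), of "word_const r xs + 1"] W by simp
  show "word_const r xs \<le> word_const r (j # xs)" unfolding eq by (rule order_trans[OF _ A]) simp
  have B: "X \<le> X * (word_const r xs + 1)"
    using mult_left_mono[of 1 "word_const r xs + 1" X] X W by simp
  show "iter_const (nat \<bar>r j\<bar>) \<le> word_const r (j # xs)" unfolding eq using X(2) B by (rule order_trans)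
qed

text \<open>orbit_const K B k = \<Sum>_{i<k} B^i K^(k-i): the error accumulated along k steps of an
  orbit when each step contributes K and earlier errors are multiplied by B.\<close>
fun orbit_const :: "real \<Rightarrow> real \<Rightarrow> nat \<Rightarrow> real" where
  "orbit_const K B 0 = 0"
| "orbit_const K B (Suc k) = K * K ^ k + B * orbit_const K B k"

lemma orbit_const_nonneg: "0 \<le> K \<Longrightarrow> 0 \<le> B \<Longrightarrow> 0 \<le> orbit_const K B k"
  by (induction k) auto

section \<open>Linear approximation of words in near-identity generators\<close>

text \<open>A family of bijections g_j of M which are \<epsilon>-close to the identity and whose
  displacements G_j = g_j - id are c-Lipschitz at scales below \<delta>, with c \<le> 1/2.\<close>
locale near_identity_family =
  fixes M :: "(real^'l) set" and g :: "'n::finite \<Rightarrow> real^'l \<Rightarrow> real^'l" and \<epsilon> c \<delta> :: real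
  assumes g_bij: "\<And>j. bij_betw (g j) M M"
    and g_small: "\<And>j z. z \<in> M \<Longrightarrow> norm (g j z - z) \<le> \<epsilon>"
    and g_lipschitz: "\<And>j x z. x \<in> M \<Longrightarrow> z \<in> M \<Longrightarrow> norm (z - x) < \<delta> \<Longrightarrow>
                       norm ((g j z - z) - (g j x - x)) \<le> c * norm (z - x)"
    and c_nonneg: "0 \<le> c" and c_le_half: "c \<le> 1/2"
    and \<epsilon>_nonneg: "0 \<le> \<epsilon>" and \<epsilon>_less_\<delta>: "\<epsilon> < \<delta>"
begin

text \<open>The largest generator displacement at z, max_j |G_j(z)|.\<close>
definition max_disp :: "real^'l \<Rightarrow> real" where
  "max_disp z = Max (range (\<lambda>j. norm (g j z - z)))"

text \<open>max_disp z is the least common bound of the displacements at z.\<close>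
lemma max_disp_ge: "norm (g j z - z) \<le> max_disp z"
  unfolding max_disp_def by (intro Max_ge) auto

lemma max_disp_least: "(\<And>j. norm (g j z - z) \<le> B) \<Longrightarrow> max_disp z \<le> B"
  unfolding max_disp_def by (subst Max_le_iff) auto

lemma max_disp_nonneg: "0 \<le> max_disp z"
  using max_disp_ge[of undefined z] norm_ge_zero order_trans by blast

lemma max_disp_small: "z \<in> M \<Longrightarrow> max_disp z \<le> \<epsilon>"
  using g_small by (intro max_disp_least)

text \<open>The generators and their inverses (on M) map M into M.\<close>
lemma g_maps: "z \<in> M \<Longrightarrow> g j z \<in> M"
  using g_bij bij_betwE by blast

lemma g_inv: "z \<in> M \<Longrightarrow> inv_into M (g j) z \<in> M \<and> g j (inv_into M (g j) z) = z"
  using g_bij by (metis bij_betw_def f_inv_into_f inv_into_into)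

text \<open>Displacements vary by at most c times the distance between nearby points; the same
  holds for their linear combinations.\<close>
lemma displacement_shift:
  assumes "x \<in> M" "z \<in> M" "norm (z - x) < \<delta>"
  shows "norm (g j z - z) \<le> max_disp x + c * norm (z - x)"
proof -
  have "norm (g j z - z) \<le> norm (g j x - x) + norm ((g j z - z) - (g j x - x))"
    by (rule norm_triangle_sub)
  then show ?thesis using max_disp_ge[of j x] g_lipschitz[OF assms, of j] by linarith
qed

lemma lin_comb_displacement_shift:
  assumes "x \<in> M" "z \<in> M" "norm (z - x) < \<delta>"
  shows "norm (\<Sum>j\<in>UNIV. a j *\<^sub>R ((g j z - z) - (g j x - x))) \<le> (\<Sum>j\<in>UNIV. \<bar>a j\<bar>) * (c * norm (z - x))"
proof -
  have "norm (\<Sum>j\<in>UNIV. a j *\<^sub>R ((g j z - z) - (g j x - x)))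
      \<le> (\<Sum>j\<in>UNIV. norm (a j *\<^sub>R ((g j z - z) - (g j x - x))))"
    by (rule norm_sum)
  also have "\<dots> \<le> (\<Sum>j\<in>UNIV. \<bar>a j\<bar> * (c * norm (z - x)))"
    using g_lipschitz[OF assms] by (intro sum_mono) (simp add: mult_left_mono)
  finally show ?thesis by (simp add: sum_distrib_right)
qed

text \<open>The key notion: \<phi> moves each point z of M by at most N times the maximal displacement
  of the generators at z, and up to an error c N max_disp z it acts like the linear
  combination \<Sum> a_j G_j of the generator displacements.\<close>
definition linear_approx :: "(real^'l \<Rightarrow> real^'l) \<Rightarrow> ('n \<Rightarrow> real) \<Rightarrow> real \<Rightarrow> bool" where
  "linear_approx \<phi> a N \<longleftrightarrow> (\<Sum>j\<in>UNIV. \<bar>a j\<bar>) \<le> N \<and>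
     (\<forall>z\<in>M. \<phi> z \<in> M \<and> norm (\<phi> z - z) \<le> N * max_disp z \<and>
        norm (\<phi> z - z - (\<Sum>j\<in>UNIV. a j *\<^sub>R (g j z - z))) \<le> N * c * max_disp z)"

text \<open>Basic properties: the constant is non-negative and may be enlarged.\<close>
lemma linear_approx_nonneg: "linear_approx \<phi> a N \<Longrightarrow> 0 \<le> N"
  unfolding linear_approx_def by (meson order_trans sum_nonneg abs_ge_zero)

text \<open>A linearly approximated map is N \<epsilon>-close to the identity.\<close>
lemma linear_approx_small:
  assumes "linear_approx \<phi> a N" "z \<in> M"
  shows "norm (\<phi> z - z) \<le> N * \<epsilon>"
  using assms linear_approx_nonneg[OF assms(1)] max_disp_small[OF assms(2)]
  unfolding linear_approx_def by (meson mult_left_mono order_trans)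

lemma linear_approx_mono:
  assumes "linear_approx \<phi> a N" "N \<le> N'"
  shows "linear_approx \<phi> a N'"
proof -
  have "N * max_disp z \<le> N' * max_disp z" "N * c * max_disp z \<le> N' * c * max_disp z" for z
    using assms(2) c_nonneg max_disp_nonneg[of z] by (auto intro!: mult_right_mono)
  then show ?thesis using assms unfolding linear_approx_def by (meson order_trans)
qed

text \<open>The identity and the generators are linearly approximated with constants 0 and 1.\<close>
lemma linear_approx_id: "linear_approx id (\<lambda>_. 0) 0"
  unfolding linear_approx_def by simp

lemma linear_approx_gen: "linear_approx (g j) (\<lambda>i. if i = j then 1 else 0) 1"
  unfolding linear_approx_def
  using g_maps max_disp_ge c_nonneg max_disp_nonneg by (simp add: sum_delta_scaleR sum_delta_abs)

text \<open>The inverse of a generator moves points by at most twice the maximal displacement,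
  since the displacement is almost constant at the small scale it moves.\<close>
lemma linear_approx_gen_inv: "linear_approx (inv_into M (g j)) (\<lambda>i. if i = j then -1 else 0) 2"
proof -
  have "norm (w - z) \<le> 2 * max_disp z \<and> norm (w - z - - (g j z - z)) \<le> 2 * c * max_disp z"
    if z: "z \<in> M" and w: "w = inv_into M (g j) z" for z w
  proof -
    have wM: "w \<in> M" and gw: "g j w = z" using g_inv[OF z] w by auto
    have nwz: "norm (w - z) = norm (g j w - w)" using gw by (simp add: norm_minus_commute)
    have close: "norm (w - z) < \<delta>" using nwz g_small[OF wM, of j] \<epsilon>_less_\<delta> by simp
    have "norm (w - z) \<le> max_disp z + c * norm (w - z)"
      using displacement_shift[OF z wM close, of j] nwz by simp
    then have A: "norm (w - z) \<le> 2 * max_disp z"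
      using le_twice_if_le_plus_half c_le_half by simp
    have "w - z - - (g j z - z) = - ((g j w - w) - (g j z - z))" using gw by simp
    then have "norm (w - z - - (g j z - z)) \<le> c * norm (w - z)"
      using g_lipschitz[OF z wM close, of j] by (simp only: norm_minus_cancel)
    also have "\<dots> \<le> c * (2 * max_disp z)" using A c_nonneg by (rule mult_left_mono)
    finally show ?thesis using A by simp
  qed
  moreover have "(\<Sum>i\<in>UNIV. \<bar>if i = j then -1 else 0\<bar>) \<le> (2::real)"
    using sum_delta_abs[of j "-1"] by simp
  ultimately show ?thesis
    unfolding linear_approx_def using g_inv by (simp add: sum_delta_scaleR)
qed

text \<open>The defining estimates, with max_disp replaced by any upper bound B.\<close>
lemma linear_approx_at:
  assumes A: "linear_approx \<phi> a N" and w: "w \<in> M" and B: "max_disp w \<le> B"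
  shows "\<phi> w \<in> M" and "norm (\<phi> w - w) \<le> N * B"
    and "norm (\<phi> w - w - (\<Sum>j\<in>UNIV. a j *\<^sub>R (g j w - w))) \<le> N * c * B"
proof -
  have N: "0 \<le> N" using A by (rule linear_approx_nonneg)
  have "N * max_disp w \<le> N * B" "N * c * max_disp w \<le> N * c * B"
    using B N c_nonneg by (simp_all add: mult_left_mono)
  then show "\<phi> w \<in> M" "norm (\<phi> w - w) \<le> N * B"
    and "norm (\<phi> w - w - (\<Sum>j\<in>UNIV. a j *\<^sub>R (g j w - w))) \<le> N * c * B"
    using A w unfolding linear_approx_def by (meson order_trans)+
qed

text \<open>A linearly approximated map moves z by less than \<delta>, and the maximal displacement at the
  image point exceeds that at z by at most the factor 1 + N.\<close>
lemma max_disp_after_approx: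
  assumes A: "linear_approx \<phi> a N" and small: "N * \<epsilon> < \<delta>" and z: "z \<in> M"
  shows "norm (\<phi> z - z) < \<delta>" and "max_disp (\<phi> z) \<le> (1 + N) * max_disp z"
proof -
  show close: "norm (\<phi> z - z) < \<delta>" using linear_approx_small[OF A z] small by simp
  have wM: "\<phi> z \<in> M" and wz: "norm (\<phi> z - z) \<le> N * max_disp z"
    using linear_approx_at[OF A z order_refl] by simp_all
  show "max_disp (\<phi> z) \<le> (1 + N) * max_disp z"
  proof (rule max_disp_least)
    fix j
    have "norm (g j (\<phi> z) - \<phi> z) \<le> max_disp z + c * norm (\<phi> z - z)"
      by (rule displacement_shift[OF z wM close])
    also have "c * norm (\<phi> z - z) \<le> 1 * (N * max_disp z)"
      using c_nonneg c_le_half wz by (intro mult_mono) auto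
    finally show "norm (g j (\<phi> z) - \<phi> z) \<le> (1 + N) * max_disp z" by (simp add: algebra_simps)
  qed
qed

text \<open>Composition: the errors of the two factors add up; the inner map moves the base point
  by at most N2 max_disp z, across which the displacements change by at most c times that.\<close>
lemma linear_approx_comp_at:
  assumes A1: "linear_approx \<phi>1 a1 N1" and A2: "linear_approx \<phi>2 a2 N2"
    and small: "N2 * \<epsilon> < \<delta>" and z: "z \<in> M"
  shows "norm (\<phi>1 (\<phi>2 z) - z) \<le> (N1 * (1 + N2) + N2) * max_disp z"
    and "norm (\<phi>1 (\<phi>2 z) - z - (\<Sum>j\<in>UNIV. (a1 j + a2 j) *\<^sub>R (g j z - z)))
           \<le> (N1 * (1 + N2) + N1 * N2 + N2) * c * max_disp z"
proof -
  define w where "w = \<phi>2 z"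
  define m where "m = max_disp z"
  have N1: "0 \<le> N1" using A1 by (rule linear_approx_nonneg)
  note at_z = linear_approx_at[OF A2 z order_refl]
  have wM: "w \<in> M" and wz: "norm (w - z) \<le> N2 * m"
    and e2: "norm (w - z - (\<Sum>j\<in>UNIV. a2 j *\<^sub>R (g j z - z))) \<le> N2 * c * m"
    using at_z unfolding w_def m_def by simp_all
  have close: "norm (w - z) < \<delta>" and dw: "max_disp w \<le> (1 + N2) * m"
    using max_disp_after_approx[OF A2 small z] unfolding w_def m_def by simp_all
  note at_w = linear_approx_at[OF A1 wM dw]
  have "norm (\<phi>1 w - z) \<le> norm (\<phi>1 w - w) + norm (w - z)"
    using norm_triangle_ineq[of "\<phi>1 w - w" "w - z"] by simp
  then show "norm (\<phi>1 (\<phi>2 z) - z) \<le> (N1 * (1 + N2) + N2) * max_disp z"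
    using at_w(2) wz unfolding w_def[symmetric] m_def[symmetric] by (simp add: algebra_simps)
  have mid: "norm (\<Sum>j\<in>UNIV. a1 j *\<^sub>R ((g j w - w) - (g j z - z))) \<le> N1 * (c * (N2 * m))"
  proof -
    have "(\<Sum>j\<in>UNIV. \<bar>a1 j\<bar>) * (c * norm (w - z)) \<le> N1 * (c * (N2 * m))"
      using A1 wz c_nonneg N1 unfolding linear_approx_def by (intro mult_mono) (auto intro: mult_left_mono)
    then show ?thesis using lin_comb_displacement_shift[OF z wM close, of a1] by linarith
  qed
  have split: "\<phi>1 w - z - (\<Sum>j\<in>UNIV. (a1 j + a2 j) *\<^sub>R (g j z - z))
      = (\<phi>1 w - w - (\<Sum>j\<in>UNIV. a1 j *\<^sub>R (g j w - w)))
        + (\<Sum>j\<in>UNIV. a1 j *\<^sub>R ((g j w - w) - (g j z - z)))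
        + (w - z - (\<Sum>j\<in>UNIV. a2 j *\<^sub>R (g j z - z)))"
    by (simp add: scaleR_add_left scaleR_diff_right sum.distrib sum_subtractf algebra_simps)
  have "norm (\<phi>1 w - z - (\<Sum>j\<in>UNIV. (a1 j + a2 j) *\<^sub>R (g j z - z)))
      \<le> N1 * c * ((1 + N2) * m) + N1 * (c * (N2 * m)) + N2 * c * m"
    unfolding split using norm_add3_le at_w(3) mid e2 by (smt (verit))
  then show "norm (\<phi>1 (\<phi>2 z) - z - (\<Sum>j\<in>UNIV. (a1 j + a2 j) *\<^sub>R (g j z - z)))
           \<le> (N1 * (1 + N2) + N1 * N2 + N2) * c * max_disp z"
    unfolding w_def[symmetric] m_def[symmetric] by (simp add: algebra_simps)
qed

text \<open>Composition: the coefficient vectors add and the constant grows polynomially, provided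
  the inner map moves points less than \<delta>.\<close>
lemma linear_approx_comp:
  assumes A1: "linear_approx \<phi>1 a1 N1" and A2: "linear_approx \<phi>2 a2 N2"
    and small: "N2 * \<epsilon> < \<delta>" and N: "2 * (N1 + 1) * (N2 + 1) \<le> N"
  shows "linear_approx (\<phi>1 \<circ> \<phi>2) (\<lambda>j. a1 j + a2 j) N"
proof -
  have N1: "0 \<le> N1" and N2: "0 \<le> N2"
    using linear_approx_nonneg[OF A1] linear_approx_nonneg[OF A2] .
  have "N1 * (1 + N2) + N1 * N2 + N2 \<le> 2 * (N1 + 1) * (N2 + 1)"
    using N1 N2 by (simp add: algebra_simps)
  then have b2: "N1 * (1 + N2) + N1 * N2 + N2 \<le> N" using N by linarith
  have P: "0 \<le> N1 * N2" and expand: "N1 * (1 + N2) = N1 + N1 * N2"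
    using N1 N2 by (simp_all add: algebra_simps)
  have b1: "N1 * (1 + N2) + N2 \<le> N" using b2 P by linarith
  have "(\<Sum>j\<in>UNIV. \<bar>a1 j + a2 j\<bar>) \<le> (\<Sum>j\<in>UNIV. \<bar>a1 j\<bar>) + (\<Sum>j\<in>UNIV. \<bar>a2 j\<bar>)"
    by (simp add: sum.distrib[symmetric] sum_mono abs_triangle_ineq)
  also have "\<dots> \<le> N1 + N2" using A1 A2 unfolding linear_approx_def by (simp add: add_mono)
  also have "\<dots> \<le> N" using b1 P expand by linarith
  finally have sum: "(\<Sum>j\<in>UNIV. \<bar>a1 j + a2 j\<bar>) \<le> N" .
  have "(\<phi>1 \<circ> \<phi>2) z \<in> M \<and> norm ((\<phi>1 \<circ> \<phi>2) z - z) \<le> N * max_disp z \<and>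
      norm ((\<phi>1 \<circ> \<phi>2) z - z - (\<Sum>j\<in>UNIV. (a1 j + a2 j) *\<^sub>R (g j z - z))) \<le> N * c * max_disp z"
    if z: "z \<in> M" for z
  proof -
    have "(\<phi>1 \<circ> \<phi>2) z \<in> M" using A1 A2 z unfolding linear_approx_def by simp
    moreover have "(N1 * (1 + N2) + N2) * max_disp z \<le> N * max_disp z"
      and "(N1 * (1 + N2) + N1 * N2 + N2) * c * max_disp z \<le> N * c * max_disp z"
      using b1 b2 c_nonneg max_disp_nonneg[of z] by (simp_all add: mult_right_mono)
    ultimately show ?thesis
      using linear_approx_comp_at[OF A1 A2 small z] by auto
  qed
  then show ?thesis unfolding linear_approx_def using sum by blast
qed

text \<open>Powers of a map approximated with constant 2 (a generator or its inverse).\<close>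
lemma linear_approx_iterate:
  assumes \<phi>: "linear_approx \<phi> a 2" and small: "iter_const n * \<epsilon> < \<delta>"
  shows "linear_approx (\<phi> ^^ n) (\<lambda>j. real n * a j) (iter_const n)"
  using small
proof (induction n)
  case 0
  then show ?case using linear_approx_id by (simp add: id_def)
next
  case (Suc n)
  have "iter_const n * \<epsilon> \<le> iter_const (Suc n) * \<epsilon>"
    using iter_const_mono \<epsilon>_nonneg by (rule mult_right_mono)
  then have small_n: "iter_const n * \<epsilon> < \<delta>" using Suc.prems by linarith
  have "linear_approx (\<phi> \<circ> \<phi> ^^ n) (\<lambda>j. a j + real n * a j) (iter_const (Suc n))"
    using linear_approx_comp[OF \<phi> Suc.IH[OF small_n] small_n] by simp
  moreover have "(\<lambda>j. a j + real n * a j) = (\<lambda>j. real (Suc n) * a j)"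
    by (simp add: algebra_simps)
  ultimately show ?case by (simp add: comp_def)
qed

text \<open>Integer powers g_j^m are approximated by m times the j-th unit vector.\<close>
lemma linear_approx_ipow:
  assumes small: "iter_const (nat \<bar>m\<bar>) * \<epsilon> < \<delta>"
  shows "linear_approx (ipow M (g j) m) (\<lambda>i. if i = j then of_int m else 0) (iter_const (nat \<bar>m\<bar>))"
proof (cases "m \<ge> 0")
  case True
  have "linear_approx (g j) (\<lambda>i. if i = j then 1 else 0) 2"
    using linear_approx_gen by (rule linear_approx_mono) simp
  from linear_approx_iterate[OF this, of "nat m"] show ?thesis
    using True small by (simp add: ipow_def if_distrib cong: if_cong)
next
  case False
  from linear_approx_iterate[OF linear_approx_gen_inv, of "nat (- m)"] show ?thesis
    using False small by (simp add: ipow_def if_distrib cong: if_cong)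
qed

text \<open>A word along a list without repetitions is approximated by its exponent vector.\<close>
lemma linear_approx_word:
  assumes "distinct xs" "word_const r xs * \<epsilon> < \<delta>"
  shows "linear_approx (gen_word M g r xs) (\<lambda>j. if j \<in> set xs then of_int (r j) else 0) (word_const r xs)"
  using assms
proof (induction xs)
  case Nil
  then show ?case using linear_approx_id by (simp add: gen_word_def id_def)
next
  case (Cons j xs)
  have "word_const r xs * \<epsilon> \<le> word_const r (j # xs) * \<epsilon>"
    and "iter_const (nat \<bar>r j\<bar>) * \<epsilon> \<le> word_const r (j # xs) * \<epsilon>"
    by (rule mult_right_mono[OF word_const_Cons_ge(1) \<epsilon>_nonneg]
             mult_right_mono[OF word_const_Cons_ge(2) \<epsilon>_nonneg])+
  then have small: "word_const r xs * \<epsilon> < \<delta>" "iter_const (nat \<bar>r j\<bar>) * \<epsilon> < \<delta>"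
    using Cons.prems(2) by linarith+
  have IH: "linear_approx (gen_word M g r xs) (\<lambda>i. if i \<in> set xs then of_int (r i) else 0) (word_const r xs)"
    using Cons small by simp
  have "linear_approx (ipow M (g j) (r j) \<circ> gen_word M g r xs)
     (\<lambda>i. (if i = j then of_int (r j) else 0) + (if i \<in> set xs then of_int (r i) else 0)) (word_const r (j # xs))"
    by (rule linear_approx_comp[OF linear_approx_ipow[OF small(2)] IH small(1)]) simp
  moreover have "(\<lambda>i. (if i = j then of_int (r j) else 0) + (if i \<in> set xs then of_int (r i) else 0))
      = (\<lambda>i. if i \<in> set (j # xs) then of_int (r i) else (0::real))"
    using Cons.prems(1) by auto
  ultimately show ?case by (simp add: gen_word_def comp_def)
qed

end

section \<open>Near-identity actions of Gamma_A\<close>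

text \<open>A near-identity action of Gamma_A: besides the generators g_j, the map f is
  c-Lipschitz-close to the identity and satisfies f \<circ> g_i = (\<Prod>_j g_j^{A_ij}) \<circ> f on M.\<close>
locale near_identity_action = near_identity_family M g \<epsilon> c \<delta>
  for M :: "(real^'l) set" and g :: "'n::finite \<Rightarrow> real^'l \<Rightarrow> real^'l" and \<epsilon> c \<delta> :: real +
  fixes f :: "real^'l \<Rightarrow> real^'l" and A :: "int^'n^'n" and xs :: "'n list" and N :: real
  assumes f_maps: "\<And>z. z \<in> M \<Longrightarrow> f z \<in> M"
    and f_lipschitz: "\<And>x z. x \<in> M \<Longrightarrow> z \<in> M \<Longrightarrow> norm (z - x) < \<delta> \<Longrightarrow>
                       norm ((f z - z) - (f x - x)) \<le> c * norm (z - x)"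
    and relation: "\<And>i z. z \<in> M \<Longrightarrow> f (g i z) = gen_word M g (\<lambda>j. A $ i $ j) xs (f z)"
    and xs: "distinct xs" "set xs = UNIV"
    and N_bound: "\<And>i. word_const (\<lambda>j. A $ i $ j) xs \<le> N" and N_small: "N * \<epsilon> < \<delta>"
begin

text \<open>A as a real matrix.\<close>
abbreviation A_real :: "real^'n^'n" where
  "A_real \<equiv> map_matrix real_of_int A"

text \<open>The i-th relator word is approximated by the i-th row of A.\<close>
lemma row_word_approx: "linear_approx (gen_word M g (\<lambda>j. A $ i $ j) xs) (\<lambda>j. of_int (A $ i $ j)) N"
proof -
  have "word_const (\<lambda>j. A $ i $ j) xs * \<epsilon> \<le> N * \<epsilon>"
    using N_bound \<epsilon>_nonneg by (rule mult_right_mono)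
  then have "linear_approx (gen_word M g (\<lambda>j. A $ i $ j) xs) (\<lambda>j. of_int (A $ i $ j))
              (word_const (\<lambda>j. A $ i $ j) xs)"
    using linear_approx_word[OF xs(1), of "\<lambda>j. A $ i $ j"] N_small xs(2) by simp
  then show ?thesis using N_bound by (rule linear_approx_mono)
qed

text \<open>The word constant N is non-negative.\<close>
lemma N_nonneg: "0 \<le> N"
  using linear_approx_nonneg[OF row_word_approx] .

text \<open>One application of the relation: at z, the displacement of g_i is controlled by the
  displacements at f z, and agrees with \<Sum>_j A_ij G_j(f z) up to a factor c.\<close>
lemma one_step_row:
  assumes z: "z \<in> M"
  shows "norm (g i z - z) \<le> 2 * N * max_disp (f z)"
    and "norm ((g i z - z) - (\<Sum>j\<in>UNIV. of_int (A $ i $ j) *\<^sub>R (g j (f z) - f z)))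
           \<le> 3 * N * c * max_disp (f z)"
proof -
  define u where "u = g i z - z"
  define v where "v = gen_word M g (\<lambda>j. A $ i $ j) xs (f z) - f z"
  have v: "norm v \<le> N * max_disp (f z)"
    and v_lin: "norm (v - (\<Sum>j\<in>UNIV. of_int (A $ i $ j) *\<^sub>R (g j (f z) - f z))) \<le> N * c * max_disp (f z)"
    using row_word_approx[of i] f_maps[OF z] unfolding linear_approx_def v_def by auto
  have "norm (g i z - z) < \<delta>" using g_small[OF z, of i] \<epsilon>_less_\<delta> by simp
  then have "norm ((f (g i z) - g i z) - (f z - z)) \<le> c * norm u"
    using f_lipschitz[OF z g_maps[OF z]] unfolding u_def by blast
  moreover have "(f (g i z) - g i z) - (f z - z) = v - u"
    unfolding u_def v_def relation[OF z] by (simp add: algebra_simps)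
  ultimately have vu: "norm (u - v) \<le> c * norm u" by (simp add: norm_minus_commute)
  have "norm u \<le> norm v + c * norm u"
    using norm_triangle_ineq[of v "u - v"] vu by simp
  then have "norm u \<le> 2 * norm v" by (rule le_twice_if_le_plus_half[OF _ c_le_half norm_ge_zero])
  then have u: "norm u \<le> 2 * N * max_disp (f z)" using v by linarith
  then show "norm (g i z - z) \<le> 2 * N * max_disp (f z)" unfolding u_def .
  have "c * norm u \<le> c * (2 * N * max_disp (f z))" using u c_nonneg by (rule mult_left_mono)
  then have "norm (u - v) \<le> c * (2 * N * max_disp (f z))" using vu by linarith
  then have "norm (u - (\<Sum>j\<in>UNIV. of_int (A $ i $ j) *\<^sub>R (g j (f z) - f z)))
      \<le> c * (2 * N * max_disp (f z)) + N * c * max_disp (f z)"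
    using v_lin by (rule norm_diff_triangle_le)
  also have "\<dots> = 3 * N * c * max_disp (f z)" by (simp add: algebra_simps)
  finally show "norm ((g i z - z) - (\<Sum>j\<in>UNIV. of_int (A $ i $ j) *\<^sub>R (g j (f z) - f z)))
           \<le> 3 * N * c * max_disp (f z)"
    unfolding u_def .
qed

text \<open>A constant covering both estimates of one_step_row after summing over rows.\<close>
definition step_const :: real where
  "step_const = real CARD('n) * (3 * N)"

lemma step_const_ge: "2 * N \<le> step_const" "0 \<le> step_const"
proof -
  have "1 * (3 * N) \<le> real CARD('n) * (3 * N)" using N_nonneg by (intro mult_right_mono) auto
  then show "2 * N \<le> step_const" "0 \<le> step_const" unfolding step_const_def using N_nonneg by simp_all
qed

text \<open>One step of the relation in matrix form: D(z) is controlled by D(f z), and each column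
  of D(z) equals A times the corresponding column of D(f z) up to a factor c.\<close>
lemma one_step:
  assumes z: "z \<in> M"
  shows "max_disp z \<le> step_const * max_disp (f z)"
    and "norm (column (displacement g z) j - A_real *v column (displacement g (f z)) j)
           \<le> step_const * c * max_disp (f z)"
proof -
  have "norm (g i z - z) \<le> step_const * max_disp (f z)" for i
    using one_step_row(1)[OF z, of i] step_const_ge max_disp_nonneg[of "f z"]
    by (meson mult_right_mono order_trans)
  then show "max_disp z \<le> step_const * max_disp (f z)" by (rule max_disp_least)
  define e where "e i = (g i z - z) - (\<Sum>j\<in>UNIV. of_int (A $ i $ j) *\<^sub>R (g j (f z) - f z))" for i
  have "column (displacement g z) j - A_real *v column (displacement g (f z)) j = (\<chi> i. e i $ j)"
    by (simp add: vec_eq_iff column_def displacement_def e_def matrix_vector_mult_def)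
  moreover have "norm (\<chi> i. e i $ j) \<le> real CARD('n) * (3 * N * c * max_disp (f z))"
  proof (rule norm_le_card_mult_bound)
    fix i
    show "\<bar>(\<chi> i. e i $ j) $ i\<bar> \<le> 3 * N * c * max_disp (f z)"
      using component_le_norm_cart[of "e i" j] one_step_row(2)[OF z, of i] unfolding e_def by simp
  qed
  ultimately show "norm (column (displacement g z) j - A_real *v column (displacement g (f z)) j)
           \<le> step_const * c * max_disp (f z)"
    by (simp add: step_const_def mult.assoc)
qed

text \<open>Iterating one_step: the displacements at x are controlled by those at f^k x.\<close>
lemma max_disp_orbit:
  "x \<in> M \<Longrightarrow> max_disp x \<le> step_const ^ k * max_disp ((f ^^ k) x)"
proof (induction k arbitrary: x)
  case (Suc k)
  have "max_disp x \<le> step_const * max_disp (f x)" by (rule one_step(1)[OF Suc.prems])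
  also have "\<dots> \<le> step_const * (step_const ^ k * max_disp ((f ^^ k) (f x)))"
    using Suc.IH[OF f_maps[OF Suc.prems]] step_const_ge(2) by (rule mult_left_mono)
  finally show ?case by (simp add: funpow_swap1 mult.assoc)
qed simp

text \<open>The error constant after k steps along an orbit of f.\<close>
definition orbit_err :: "nat \<Rightarrow> real" where
  "orbit_err k = orbit_const step_const (onorm ((*v) A_real)) k"

text \<open>Iterating one_step along the orbit: the k-th column relation holds up to
  orbit_err k * c * max_disp (f^k x).\<close>
lemma column_orbit:
  "x \<in> M \<Longrightarrow> norm (column (displacement g x) j - mat_pow A_real k *v column (displacement g ((f ^^ k) x)) j)
      \<le> orbit_err k * c * max_disp ((f ^^ k) x)"
proof (induction k arbitrary: x)
  case 0
  then show ?case by (simp add: mat_pow_def orbit_err_def)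
next
  case (Suc k)
  define w where "w = f x"
  define y where "y = (f ^^ k) w"
  have wM: "w \<in> M" using f_maps[OF Suc.prems] by (simp add: w_def)
  have y: "(f ^^ Suc k) x = y" by (simp add: y_def w_def funpow_swap1)
  define v1 where "v1 = column (displacement g x) j - A_real *v column (displacement g w) j"
  define v2 where "v2 = column (displacement g w) j - mat_pow A_real k *v column (displacement g y) j"
  have split: "column (displacement g x) j - mat_pow A_real (Suc k) *v column (displacement g y) j
      = v1 + A_real *v v2"
    by (simp add: v1_def v2_def mat_pow_def matrix_vector_mul_assoc[symmetric] matrix_vector_mult_diff_distrib)
  moreover have "norm v1 \<le> step_const * c * (step_const ^ k * max_disp y)"
    using one_step(2)[OF Suc.prems, of j] max_disp_orbit[OF wM, of k] step_const_ge(2) c_nonneg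
    unfolding v1_def y_def w_def by (meson mult_left_mono mult_nonneg_nonneg order_trans)
  moreover have "norm (A_real *v v2) \<le> onorm ((*v) A_real) * (orbit_err k * c * max_disp y)"
    using onorm[OF matrix_vector_mul_bounded_linear, of A_real v2] Suc.IH[OF wM]
      onorm_pos_le[OF matrix_vector_mul_bounded_linear, of A_real]
    unfolding v2_def y_def by (meson mult_left_mono order_trans)
  ultimately have "norm (column (displacement g x) j - mat_pow A_real (Suc k) *v column (displacement g y) j)
      \<le> step_const * c * (step_const ^ k * max_disp y) + onorm ((*v) A_real) * (orbit_err k * c * max_disp y)"
    unfolding split using norm_triangle_ineq[of v1 "A_real *v v2"] by linarith
  also have "\<dots> = orbit_err (Suc k) * c * max_disp y"
    by (simp add: orbit_err_def algebra_simps)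
  finally show ?case unfolding y .
qed

text \<open>The orbit error constant is non-negative.\<close>
lemma orbit_err_nonneg: "0 \<le> orbit_err k"
  unfolding orbit_err_def
  using step_const_ge(2) onorm_pos_le[OF matrix_vector_mul_bounded_linear] by (rule orbit_const_nonneg)

text \<open>The column estimate in terms of the columns at y = f^k x only.\<close>
lemma column_estimate:
  assumes x: "x \<in> M"
  shows "norm (column (displacement g x) j - mat_pow A_real k *v column (displacement g ((f ^^ k) x)) j)
         \<le> orbit_err k * real CARD('l) * c * Max (range (\<lambda>m. norm (column (displacement g ((f ^^ k) x)) m)))"
proof -
  define y where "y = (f ^^ k) x"
  have "max_disp y \<le> real CARD('l) * Max (range (\<lambda>m. norm (column (displacement g y) m)))"
    using row_norm_le_columns[of "displacement g y"] by (intro max_disp_least) (simp add: displacement_def)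
  then have "orbit_err k * c * max_disp y
      \<le> orbit_err k * c * (real CARD('l) * Max (range (\<lambda>m. norm (column (displacement g y) m))))"
    using orbit_err_nonneg c_nonneg by (intro mult_left_mono) auto
  then show ?thesis using column_orbit[OF x, of j k] unfolding y_def by (simp add: algebra_simps)
qed

end

section \<open>Proof of the theorem\<close>

text \<open>The relations of Gamma_A read as f \<circ> g_i = (\<Prod>_j g_j^(A_ij)) \<circ> f on M.\<close>
lemma GammaA_action_relation:
  assumes action: "GammaA_action M A f g" and xs: "distinct xs" "set xs = UNIV" and z: "z \<in> M"
  shows "f (g i z) = gen_word M g (\<lambda>j. A $ i $ j) xs (f z)"
proof -
  have "\<forall>x\<in>M. f (g i (inv_into M f x)) = foldr (\<lambda>j acc. ipow M (g j) (A $ i $ j) \<circ> acc) xs id x"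
    using action xs unfolding GammaA_action_def by blast
  moreover have "bij_betw f M M" using action unfolding GammaA_action_def C1_diffeo_on_def by blast
  then have "f z \<in> M" "inv_into M f (f z) = z" using z by (auto simp: bij_betw_def bij_betwE)
  ultimately show ?thesis unfolding gen_word_def by metis
qed

text \<open>d_{C^1}(\<rho>, id) < \<epsilon> bounds the C^1 distance of f and of every g_i.\<close>
lemma dist_C1_action_bounds:
  assumes "dist_C1_action M f g < \<epsilon>"
  shows "dist_C1_id M f \<le> \<epsilon>" and "dist_C1_id M (g i) \<le> \<epsilon>"
proof -
  have "dist_C1_id M f < \<epsilon>" and max: "Max (range (\<lambda>i. dist_C1_id M (g i))) < \<epsilon>"
    using assms unfolding dist_C1_action_def max_less_iff_conj by blast+
  then show "dist_C1_id M f \<le> \<epsilon>" by simp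
  have "dist_C1_id M (g i) \<le> Max (range (\<lambda>i. dist_C1_id M (g i)))" by (intro Max_ge) auto
  then show "dist_C1_id M (g i) \<le> \<epsilon>" using max by linarith
qed

text \<open>A C^1 action that is close enough to the identity is a near-identity action, with
  Lipschitz constant c = C \<epsilon> for the displacements.\<close>
lemma close_action_near_identity:
  fixes M :: "(real^'l) set" and A :: "int^'n::finite^'n" and g :: "'n \<Rightarrow> real^'l \<Rightarrow> real^'l"
  assumes cM: "compact M" and C: "C \<ge> 0"
    and joins: "\<And>x z. x \<in> M \<Longrightarrow> z \<in> M \<Longrightarrow> norm (z - x) < \<delta> \<Longrightarrow> joined_in M x z (C * norm (z - x))"
    and action: "GammaA_action M A f g" and close: "dist_C1_action M f g < \<epsilon>"
    and xs: "distinct xs" "set xs = UNIV"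
    and N: "\<And>i. word_const (\<lambda>j. A $ i $ j) xs \<le> N"
    and \<epsilon>: "0 < \<epsilon>" "C * \<epsilon> \<le> 1/2" "(N + 1) * \<epsilon> < \<delta>"
  shows "near_identity_action M g \<epsilon> (C * \<epsilon>) \<delta> f A xs N"
proof -
  have f: "bij_betw f M M" "C1_map_on M f" and g: "\<And>i. bij_betw (g i) M M" "\<And>i. C1_map_on M (g i)"
    using action unfolding GammaA_action_def C1_diffeo_on_def by auto
  note df = dist_C1_action_bounds(1)[OF close] and dg = dist_C1_action_bounds(2)[OF close]
  have "0 \<le> N" using N word_const_nonneg order_trans by blast
  moreover have "(N + 1) * \<epsilon> = N * \<epsilon> + \<epsilon>" by (simp add: algebra_simps)
  ultimately have small: "N * \<epsilon> < \<delta>" "\<epsilon> < \<delta>"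
    using \<epsilon>(1,3) mult_nonneg_nonneg[of N \<epsilon>] by linarith+
  show ?thesis
  proof unfold_locales
    show "norm (g j z - z) \<le> \<epsilon>" if "z \<in> M" for j z
      by (rule displacement_controlled_by_C1_dist(1)[of M "g j" C \<epsilon> \<delta>, OF cM g(2) C dg joins that])
    show "norm ((g j z - z) - (g j x - x)) \<le> C * \<epsilon> * norm (z - x)"
      if "x \<in> M" "z \<in> M" "norm (z - x) < \<delta>" for j x z
      by (rule displacement_controlled_by_C1_dist(2)[of M "g j" C \<epsilon> \<delta>, OF cM g(2) C dg joins that])
    show "norm ((f z - z) - (f x - x)) \<le> C * \<epsilon> * norm (z - x)"
      if "x \<in> M" "z \<in> M" "norm (z - x) < \<delta>" for x z
      by (rule displacement_controlled_by_C1_dist(2)[of M f C \<epsilon> \<delta>, OF cM f(2) C df joins that])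
    show "f (g i z) = gen_word M g (\<lambda>j. A $ i $ j) xs (f z)" if "z \<in> M" for i z
      by (rule GammaA_action_relation[OF action xs that])
    show "f z \<in> M" if "z \<in> M" for z using f(1) that bij_betwE by blast
  qed (use g(1) xs N small \<epsilon> C in auto)
qed

text \<open>All smallness requirements on \<epsilon> can be met simultaneously.\<close>
lemma epsilon_choice:
  fixes \<delta> C N K \<eta> :: real
  assumes "0 < \<delta>" "0 \<le> C" "0 \<le> N" "0 \<le> K" "0 < \<eta>"
  obtains \<epsilon> where "0 < \<epsilon>" "C * \<epsilon> \<le> 1/2" "(N + 1) * \<epsilon> < \<delta>" "K * (C * \<epsilon>) \<le> \<eta>"
proof
  define \<epsilon> where "\<epsilon> = min (1 / (2 * (C + 1))) (min (\<delta> / (2 * (N + 1))) (\<eta> / ((K + 1) * (C + 1))))"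
  show "0 < \<epsilon>" unfolding \<epsilon>_def using assms by auto
  have "C * \<epsilon> \<le> (C + 1) * (1 / (2 * (C + 1)))"
    using assms \<open>0 < \<epsilon>\<close> by (intro mult_mono) (auto simp: \<epsilon>_def)
  also have "\<dots> = 1/2" using assms by (simp add: field_simps)
  finally show "C * \<epsilon> \<le> 1/2" .
  have "(N + 1) * \<epsilon> \<le> (N + 1) * (\<delta> / (2 * (N + 1)))"
    using assms by (intro mult_left_mono) (auto simp: \<epsilon>_def)
  also have "\<dots> = \<delta> / 2" using assms by (simp add: field_simps)
  finally show "(N + 1) * \<epsilon> < \<delta>" using assms by linarith
  have "K * (C * \<epsilon>) \<le> ((K + 1) * (C + 1)) * \<epsilon>"
    using assms \<open>0 < \<epsilon>\<close> by (simp add: algebra_simps mult_right_mono)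
  also have "\<dots> \<le> ((K + 1) * (C + 1)) * (\<eta> / ((K + 1) * (C + 1)))"
    using assms by (intro mult_left_mono) (auto simp: \<epsilon>_def)
  finally show "K * (C * \<epsilon>) \<le> \<eta>" using assms by simp
qed

text \<open>Final bookkeeping: an error B My with B \<le> \<eta> is dominated by the right-hand side of the
  theorem, since the square root factor is at least 1.\<close>
lemma bound_by_column_maxima:
  fixes e B \<eta> Mx My s :: real
  assumes "e \<le> B * My" "0 \<le> B" "B \<le> \<eta>" "0 \<le> Mx" "0 \<le> My" "1 \<le> s"
  shows "e \<le> \<eta> * s * (2 * Mx + My)"
proof -
  have "B * My \<le> \<eta> * (1 * My)" using assms by (simp add: mult_right_mono)
  also have "\<dots> \<le> \<eta> * (s * (2 * Mx + My))"
    using assms by (intro mult_left_mono mult_mono) auto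
  finally show ?thesis using assms(1) by (simp add: mult.assoc)
qed

text \<open>The factor sqrt(n l) of the theorem is at least 1.\<close>
lemma one_le_sqrt_card_prod: "1 \<le> sqrt (real (CARD('n::finite) * CARD('l::finite)))"
proof -
  have "1 \<le> CARD('n) * CARD('l)" by (simp add: Suc_le_eq)
  then have "1 \<le> real (CARD('n) * CARD('l))" by (metis of_nat_1 of_nat_le_iff)
  then show ?thesis using real_sqrt_le_mono by fastforce
qed

text \<open>The theorem for a fixed \<eta>, with \<epsilon> chosen from the path constants of M, the word
  constants of A and k.\<close>
lemma close_actions_estimate:
  fixes M :: "(real^'l) set" and A :: "int^'n::finite^'n" and k :: nat
  assumes M: "compact_manifold M" and \<eta>: "\<eta> > 0"
  obtains \<epsilon> where "\<epsilon> > 0"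
    and "\<And>f g x j. GammaA_action M A f g \<Longrightarrow> dist_C1_action M f g < \<epsilon> \<Longrightarrow> x \<in> M \<Longrightarrow>
      norm (column (displacement g x) j
            - mat_pow (map_matrix real_of_int A) k *v column (displacement g ((f ^^ k) x)) j)
      \<le> \<eta> * sqrt (real (CARD('n) * CARD('l))) *
         (2 * Max (range (\<lambda>m. norm (column (displacement g x) m)))
            + Max (range (\<lambda>m. norm (column (displacement g ((f ^^ k) x)) m))))"
proof -
  have cM: "compact M" using M unfolding compact_manifold_def by simp
  obtain \<delta> C where \<delta>C: "\<delta> > 0" "C \<ge> 0"
    and joins: "\<And>x z. x \<in> M \<Longrightarrow> z \<in> M \<Longrightarrow> norm (z - x) < \<delta> \<Longrightarrow> joined_in M x z (C * norm (z - x))"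
    by (rule compact_manifold_joins[OF M]) blast
  obtain xs :: "'n list" where xs: "distinct xs" "set xs = UNIV"
    using finite_distinct_list[of "UNIV :: 'n set"] by auto
  define N where "N = (\<Sum>i\<in>UNIV. word_const (\<lambda>j. A $ i $ j) xs)"
  have N: "\<And>i. word_const (\<lambda>j. A $ i $ j) xs \<le> N" "0 \<le> N"
    unfolding N_def by (auto intro: member_le_sum sum_nonneg word_const_nonneg)
  define K where "K = orbit_const (real CARD('n) * (3 * N))
                        (onorm ((*v) (map_matrix real_of_int A :: real^'n^'n))) k * real CARD('l)"
  have "0 \<le> K" unfolding K_def using N(2) onorm_pos_le[OF matrix_vector_mul_bounded_linear]
    by (intro mult_nonneg_nonneg orbit_const_nonneg) auto
  then obtain \<epsilon> where \<epsilon>: "0 < \<epsilon>" "C * \<epsilon> \<le> 1/2" "(N + 1) * \<epsilon> < \<delta>" "K * (C * \<epsilon>) \<le> \<eta>"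
    using epsilon_choice[OF \<delta>C N(2) _ \<eta>] by blast
  show ?thesis
  proof (rule that[OF \<epsilon>(1)])
    fix f g x j
    assume action: "GammaA_action M A f g" and close: "dist_C1_action M f g < \<epsilon>" and x: "x \<in> M"
    interpret near_identity_action M g \<epsilon> "C * \<epsilon>" \<delta> f A xs N
      by (rule close_action_near_identity[OF cM \<delta>C(2) joins action close xs N(1) \<epsilon>(1-3)])
    have K_eq: "orbit_err k * real CARD('l) = K" unfolding orbit_err_def step_const_def K_def ..
    have "0 \<le> K * (C * \<epsilon>)" using \<open>0 \<le> K\<close> c_nonneg by simp
    from column_estimate[OF x, of j k] this \<epsilon>(4) show "norm (column (displacement g x) j
            - mat_pow (map_matrix real_of_int A) k *v column (displacement g ((f ^^ k) x)) j)
      \<le> \<eta> * sqrt (real (CARD('n) * CARD('l))) *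
         (2 * Max (range (\<lambda>m. norm (column (displacement g x) m)))
            + Max (range (\<lambda>m. norm (column (displacement g ((f ^^ k) x)) m))))"
      unfolding K_eq
      by (rule bound_by_column_maxima[OF _ _ _ Max_column_norm_nonneg Max_column_norm_nonneg
                                       one_le_sqrt_card_prod])
  qed
qed

text \<open>The main theorem.\<close>
theorem mainTheorem5:
  fixes M :: "(real^'l) set" and A :: "int^'n^'n" and k :: nat
  assumes "compact_manifold M"
    and "det (map_matrix real_of_int A) \<noteq> 0"
    and "k \<ge> 1"
  shows "\<forall>\<eta>>0. \<exists>\<epsilon>>0. \<forall>(f :: real^'l \<Rightarrow> real^'l) (g :: 'n \<Rightarrow> real^'l \<Rightarrow> real^'l).
     GammaA_action M A f g \<and> dist_C1_action M f g < \<epsilon> \<longrightarrow>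
     (\<forall>x\<in>M. let y = (f ^^ k) x in \<forall>j.
        norm (column (displacement g x) j
              - mat_pow (map_matrix real_of_int A) k *v column (displacement g y) j)
        \<le> \<eta> * sqrt (real (CARD('n) * CARD('l))) *
           (2 * Max (range (\<lambda>m. norm (column (displacement g x) m)))
              + Max (range (\<lambda>m. norm (column (displacement g y) m)))))"
proof (intro allI impI)
  fix \<eta> :: real assume "\<eta> > 0"
  obtain \<epsilon> where "\<epsilon> > 0" and estimate: "\<And>f g x j. GammaA_action M A f g \<Longrightarrow>
      dist_C1_action M f g < \<epsilon> \<Longrightarrow> x \<in> M \<Longrightarrow>
      norm (column (displacement g x) j
            - mat_pow (map_matrix real_of_int A) k *v column (displacement g ((f ^^ k) x)) j)
      \<le> \<eta> * sqrt (real (CARD('n) * CARD('l))) *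
         (2 * Max (range (\<lambda>m. norm (column (displacement g x) m)))
            + Max (range (\<lambda>m. norm (column (displacement g ((f ^^ k) x)) m))))"
    by (rule close_actions_estimate[where A=A and k=k, OF assms(1) \<open>\<eta> > 0\<close>]) blast
  then show "\<exists>\<epsilon>>0. \<forall>f g. GammaA_action M A f g \<and> dist_C1_action M f g < \<epsilon> \<longrightarrow>
     (\<forall>x\<in>M. let y = (f ^^ k) x in \<forall>j.
        norm (column (displacement g x) j
              - mat_pow (map_matrix real_of_int A) k *v column (displacement g y) j)
        \<le> \<eta> * sqrt (real (CARD('n) * CARD('l))) *
           (2 * Max (range (\<lambda>m. norm (column (displacement g x) m)))
              + Max (range (\<lambda>m. norm (column (displacement g y) m)))))"
    unfolding Let_def by blast
qed

end
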